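(* Let $\Sigma=\{\alpha_1,\alpha_2,\dots\}$ be an infinite countable alphabet, $\upsilon\notin\Sigma$ a variable and $\vec k=(k_n)_{n\in\mathbb N}\subseteq\mathbb N$ an increasing sequence. A family $\mathcal U\subseteq L^\infty(\Sigma,\vec k;\upsilon)$ is completely Ramsey if and only if $\mathcal U$ has the Baire property in the topology $\mathfrak T_E$.
   Context: $\mathbb N=\{1,2,\dots\}$. $L(\Sigma,\vec k;\upsilon)$: functions $w$ from a nonempty finite $\mathrm{dom}(w)\subseteq\mathbb N$ into $\Sigma\cup\{\upsilon\}$ with $w(n)\in\{\upsilon,\alpha_1,\dots,\alpha_{k_n}\}$ and $\upsilon$ attained. $w<u$ iff $\max\mathrm{dom}(w)<\min\mathrm{dom}(u)$; then $w\star u$ is the word on $\mathrm{dom}(w)\cup\mathrm{dom}(u)$ agreeing with $w,u$. $T_0(w)=w$; for $p\in\mathbb N$, $T_p(w)$ replaces each $\upsilon$ at position $n$ by $\alpha_{\min(p,k_n)}$. $L^\infty(\Sigma,\vec k;\upsilon)$: sequences $(w_n)$ with $w_n<w_{n+1}$; $EV(\vec w)$: words $T_{p_1}(w_{n_1})\star\cdots\star T_{p_\lambda}(w_{n_\lambda})$, $n_1<\dots<n_\lambda$, integers $0\le p_i\le k_{n_i}$, some $p_i=0$; $\vec u\prec\vec w$ iff $\vec u\in L^\infty$ with all terms in $EV(\vec w)$. $L^{<\infty}(\Sigma,\vec k;\upsilon)$: $\emptyset$ and tuples $(w_1,\dots,w_l)$, $w_1<\dots<w_l$. $\mathbf t\propto\vec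 w$: $\mathbf t$ is an initial segment of $\vec w$; for nonempty $\mathbf t=(t_1,\dots,t_k)$, $\vec w-\mathbf t=(w_n)_{n\ge l}$, $l=\min\{n:t_k<w_n\}$, and $\vec w-\emptyset=\vec w$. $\mathfrak T_E$ is the topology on $L^\infty(\Sigma,\vec k;\upsilon)$ with basic open sets $[\mathbf t,\vec s]=\{\vec w\in L^\infty:\mathbf t\propto\vec w,\ \vec w-\mathbf t\prec\vec s\}$, $\mathbf t\in L^{<\infty}$, $\vec s\in L^\infty$. $\mathcal U$ is completely Ramsey if for every $\mathbf t\in L^{<\infty}$ and $\vec w\in L^\infty$ there is $\vec u\prec\vec w$ with either $[\mathbf t,\vec u]\subseteq\mathcal U$ or $[\mathbf t,\vec u]\subseteq L^\infty\setminus\mathcal U$. *)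

theory Defs
  imports "HOL-Analysis.Analysis"
begin

(* The set of natural numbers of the source is {1, 2, ...}; every index and every position below is
   therefore a nat that is at least 1. The alphabet is enumerated by alpha (alpha_1, alpha_2, ...,
   the value alpha 0 is never used), v is the variable.
   A located word is a partial map; for w < u the word w * u is the library's w ++ u. *)

type_synonym 'a word = "nat \<Rightarrow> 'a option"

definition words :: "(nat \<Rightarrow> 'a) \<Rightarrow> (nat \<Rightarrow> nat) \<Rightarrow> 'a \<Rightarrow> 'a word set" where
  "words alpha k v = {w. finite (dom w) \<and> dom w \<noteq> {} \<and> dom w \<subseteq> {1..} \<and>
     (\<forall>n\<in>dom w. the (w n) \<in> insert v (alpha ` {1..k n})) \<and> v \<in> ran w}"

definition word_less :: "'a word \<Rightarrow> 'a word \<Rightarrow> bool" where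
  "word_less w u \<longleftrightarrow> Max (dom w) < Min (dom u)"

definition subst :: "(nat \<Rightarrow> 'a) \<Rightarrow> (nat \<Rightarrow> nat) \<Rightarrow> 'a \<Rightarrow> nat \<Rightarrow> 'a word \<Rightarrow> 'a word" where
  "subst alpha k v p w =
     (if p = 0 then w else (\<lambda>n. if w n = Some v then Some (alpha (min p (k n))) else w n))"

(* Sequences are indexed by {1..}; PiE fixes their irrelevant value at 0. *)
definition word_seqs :: "(nat \<Rightarrow> 'a) \<Rightarrow> (nat \<Rightarrow> nat) \<Rightarrow> 'a \<Rightarrow> (nat \<Rightarrow> 'a word) set" where
  "word_seqs alpha k v = {w \<in> {1..} \<rightarrow>\<^sub>E words alpha k v. \<forall>n\<ge>1. word_less (w n) (w (Suc n))}"

(* A list [(n_1, p_1), ..., (n_l, p_l)] encodes the word T_{p_1}(w_{n_1}) * ... * T_{p_l}(w_{n_l}). *)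
definition EV :: "(nat \<Rightarrow> 'a) \<Rightarrow> (nat \<Rightarrow> nat) \<Rightarrow> 'a \<Rightarrow> (nat \<Rightarrow> 'a word) \<Rightarrow> 'a word set" where
  "EV alpha k v w = {foldr (++) (map (\<lambda>(n, p). subst alpha k v p (w n)) xs) Map.empty | xs.
     sorted_wrt (<) (map fst xs) \<and>
     (\<forall>(n, p)\<in>set xs. 1 \<le> n \<and> p \<le> k n) \<and> (\<exists>(n, p)\<in>set xs. p = 0)}"

definition ev_prec ::
  "(nat \<Rightarrow> 'a) \<Rightarrow> (nat \<Rightarrow> nat) \<Rightarrow> 'a \<Rightarrow> (nat \<Rightarrow> 'a word) \<Rightarrow> (nat \<Rightarrow> 'a word) \<Rightarrow> bool" where
  "ev_prec alpha k v u w \<longleftrightarrow> u \<in> word_seqs alpha k v \<and> (\<forall>n\<ge>1. u n \<in> EV alpha k v w)"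

definition word_tuples :: "(nat \<Rightarrow> 'a) \<Rightarrow> (nat \<Rightarrow> nat) \<Rightarrow> 'a \<Rightarrow> 'a word list set" where
  "word_tuples alpha k v = {t. set t \<subseteq> words alpha k v \<and> sorted_wrt word_less t}"

(* Lists count from 0, sequences from 1. *)
definition init_seg :: "'a word list \<Rightarrow> (nat \<Rightarrow> 'a word) \<Rightarrow> bool" where
  "init_seg t w \<longleftrightarrow> (\<forall>i<length t. t ! i = w (Suc i))"

(* The tail (w_n) with n >= l, reindexed so that it starts at index 1. *)
definition seq_minus :: "(nat \<Rightarrow> 'a word) \<Rightarrow> 'a word list \<Rightarrow> (nat \<Rightarrow> 'a word)" where
  "seq_minus w t =
     (if t = [] then w
      else let l = (LEAST n. 1 \<le> n \<and> word_less (last t) (w n))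
           in restrict (\<lambda>i. w (l + i - 1)) {1..})"

definition basic_set ::
  "(nat \<Rightarrow> 'a) \<Rightarrow> (nat \<Rightarrow> nat) \<Rightarrow> 'a \<Rightarrow> 'a word list \<Rightarrow> (nat \<Rightarrow> 'a word) \<Rightarrow> (nat \<Rightarrow> 'a word) set" where
  "basic_set alpha k v t s =
     {w \<in> word_seqs alpha k v. init_seg t w \<and> ev_prec alpha k v (seq_minus w t) s}"

(* For nondecreasing k the sets [t, s] form a base: if w lies in [t, s] and in [t', s'], with t'
   at least as long as t, then [t', w - t'] is a neighbourhood of w contained in both. So the
   topology they generate consists exactly of their unions. *)
definition ellentuck_topology ::
  "(nat \<Rightarrow> 'a) \<Rightarrow> (nat \<Rightarrow> nat) \<Rightarrow> 'a \<Rightarrow> (nat \<Rightarrow> 'a word) topology" where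
  "ellentuck_topology alpha k v = topology_generated_by
     {basic_set alpha k v t s | t s. t \<in> word_tuples alpha k v \<and> s \<in> word_seqs alpha k v}"

definition completely_Ramsey ::
  "(nat \<Rightarrow> 'a) \<Rightarrow> (nat \<Rightarrow> nat) \<Rightarrow> 'a \<Rightarrow> (nat \<Rightarrow> 'a word) set \<Rightarrow> bool" where
  "completely_Ramsey alpha k v U \<longleftrightarrow>
     (\<forall>t\<in>word_tuples alpha k v. \<forall>w\<in>word_seqs alpha k v. \<exists>u. ev_prec alpha k v u w \<and>
        (basic_set alpha k v t u \<subseteq> U \<or> basic_set alpha k v t u \<subseteq> word_seqs alpha k v - U))"

definition nowhere_dense_in :: "'b topology \<Rightarrow> 'b set \<Rightarrow> bool" where
  "nowhere_dense_in X S \<longleftrightarrow> S \<subseteq> topspace X \<and> X interior_of (X closure_of S) = {}"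

definition meager_in :: "'b topology \<Rightarrow> 'b set \<Rightarrow> bool" where
  "meager_in X S \<longleftrightarrow> (\<exists>N :: nat \<Rightarrow> 'b set. (\<forall>i. nowhere_dense_in X (N i)) \<and> S = (\<Union>i. N i))"

definition Baire_property :: "'b topology \<Rightarrow> 'b set \<Rightarrow> bool" where
  "Baire_property X S \<longleftrightarrow>
     (\<exists>G M. openin X G \<and> meager_in X M \<and> S = (G - M) \<union> (M - G))"

end

(*
Words of EV are encoded by lists, whose concatenation extends to a compact right topological
semigroup of ultrafilters. It contains a minimal idempotent p of constant words and an idempotent q
of variable words with p q = q p = q; every substitution T_j maps q to an idempotent below p, hence
to p itself. Any set in q therefore contains all variable words built from some sequence, which is
the pigeonhole principle: for every colouring of EV(w) there is u < w with EV(u) monochromatic.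

As in Ellentuck's theorem, a fusion argument and the pigeonhole principle show that open families
are completely Ramsey. So one can pass from [t, w] to some [t, u] that misses a given nowhere dense
set, and by a second fusion to one that misses a given meager set. Conversely, if U is completely
Ramsey then U minus its interior is nowhere dense.
*)
theory Submission
  imports Defs
begin

subsection \<open>Idempotents in compact right topological semigroups\<close>

text \<open>Two features of the setting shape the proof. Concatenation of admissible lists is only
  partial, since the second list has to start past the first; ultrafilters that contain every set
  \<open>late n\<close> remedy this, because for a fixed list almost every other list starts late
  enough. And the bound on a substitution depends on the index: rewriting a word over
  \<open>u\<close> as a word over \<open>w\<close> moves a substitution j \<le> k n from the n-th
  term of \<open>u\<close> to indices i of \<open>w\<close>. The n-th term of
  \<open>u \<lhd> w\<close> only uses indices i \<ge> n, and k is nondecreasing, so j \<le> k i.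
  This is why lower bounds on indices are carried along (\<open>prec_index_le\<close>,
  \<open>EV_comp\<close>, \<open>glue\<close>). Both equations p q = q and q p = q are needed,
  because constant blocks may stand before as well as after the first variable block. Fusion meets
  finitely many requirements at a time, as only finitely many words are built from the first j
  terms; a requirement at a tuple t has to survive later changes, hence it may depend only on words
  after t.\<close>

locale compact_right_topological_semigroup =
  fixes X :: "'s topology" and m :: "'s \<Rightarrow> 's \<Rightarrow> 's"
  assumes compact: "compact_space X" and hausdorff: "Hausdorff_space X"
    and topspace_UNIV: "topspace X = UNIV"
    and assoc: "m (m p q) r = m p (m q r)"
    and continuous: "continuous_map X X (\<lambda>p. m p q)"
begin

text \<open>Right translations are continuous, so they carry the compact set \<open>A\<close> to a
  compact set, which is closed in a Hausdorff space. Left translations need not be continuous; this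
  is why left ideals \<open>C e\<close> are used below.\<close>

lemma closedin_translate:
  assumes "closedin X A" shows "closedin X ((\<lambda>p. m p q) ` A)"
proof -
  have "compactin X A"
    using assms compact closedin_compact_space by blast
  then have "compactin X ((\<lambda>p. m p q) ` A)"
    using continuous image_compactin by blast
  then show ?thesis
    using hausdorff compactin_imp_closedin by blast
qed

text \<open>Zorn's lemma on closed sets: the intersection of a chain is nonempty by compactness.
  \<open>P\<close> is left abstract so that the result serves for subsemigroups and for left ideals
  alike.\<close>

lemma exists_minimal_closed:
  assumes "closedin X A" "A \<noteq> {}" "P A"
    and Inter: "\<And>\<C>. \<C> \<noteq> {} \<Longrightarrow> (\<And>B. B \<in> \<C> \<Longrightarrow> P B) \<Longrightarrow> P (\<Inter>\<C>)"
  obtains M where "closedin X M" "M \<noteq> {}" "P M" "M \<subseteq> A"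
    "\<And>B. closedin X B \<Longrightarrow> B \<noteq> {} \<Longrightarrow> P B \<Longrightarrow> B \<subseteq> M \<Longrightarrow> B = M"
proof -
  \<comment> \<open>Complements turn minimal sets into maximal ones, the form that
    \<open>subset_Zorn_nonempty\<close> provides.\<close>
  define \<A> where "\<A> = {- B | B. closedin X B \<and> B \<noteq> {} \<and> P B \<and> B \<subseteq> A}"
  have "\<exists>M\<in>\<A>. \<forall>B\<in>\<A>. M \<subseteq> B \<longrightarrow> B = M"
  proof (rule subset_Zorn_nonempty)
    show "\<A> \<noteq> {}" using assms unfolding \<A>_def by auto
  next
    fix \<C> assume ne: "\<C> \<noteq> {}" and ch: "subset.chain \<A> \<C>"
    define \<D> where "\<D> = uminus ` \<C>"
    have D: "closedin X B \<and> B \<noteq> {} \<and> P B \<and> B \<subseteq> A" if "B \<in> \<D>" for B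
      using that ch unfolding \<D>_def \<A>_def subset_chain_def by fastforce
    have lin: "B \<subseteq> C \<or> C \<subseteq> B" if "B \<in> \<D>" "C \<in> \<D>" for B C
      using that ch unfolding \<D>_def subset_chain_def by auto
    have fin: "\<Inter>F \<in> \<D>" if "finite F" "F \<noteq> {}" "F \<subseteq> \<D>" for F
      using that
    proof (induction F rule: finite_ne_induct)
      case (insert B F)
      then have "B \<in> \<D>" "\<Inter>F \<in> \<D>" by auto
      then have "B \<inter> \<Inter>F = B \<or> B \<inter> \<Inter>F = \<Inter>F" using lin[of B "\<Inter>F"] by blast
      then show ?case using \<open>B \<in> \<D>\<close> \<open>\<Inter>F \<in> \<D>\<close> by auto
    qed auto
    have "\<D> \<noteq> {}" using ne unfolding \<D>_def by auto
    have "\<Inter>\<D> \<noteq> {}"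
    proof (rule ccontr)
      assume neg: "\<not> \<Inter>\<D> \<noteq> {}"
      have "\<Inter>F \<noteq> {}" if "finite F" "F \<subseteq> \<D>" for F
        using fin[OF that(1) _ that(2)] D by (cases "F = {}") auto
      then have "\<Inter>\<D> \<noteq> {}"
        using compact_space_fip[of X] compact D by (metis (no_types, lifting))
      then show False using neg by simp
    qed
    moreover have "closedin X (\<Inter>\<D>)" using D \<open>\<D> \<noteq> {}\<close> by blast
    moreover have "P (\<Inter>\<D>)" using Inter \<open>\<D> \<noteq> {}\<close> D by blast
    moreover have "\<Inter>\<D> \<subseteq> A" using D \<open>\<D> \<noteq> {}\<close> by blast
    moreover have "\<Union>\<C> = - \<Inter>\<D>" unfolding \<D>_def by auto
    ultimately show "\<Union>\<C> \<in> \<A>" unfolding \<A>_def by blast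
  qed
  then obtain M where M: "closedin X M" "M \<noteq> {}" "P M" "M \<subseteq> A"
    and min: "\<And>B. B \<in> \<A> \<Longrightarrow> - M \<subseteq> B \<Longrightarrow> B = - M"
    unfolding \<A>_def by auto
  have "B = M" if "closedin X B" "B \<noteq> {}" "P B" "B \<subseteq> M" for B
    using min[of "- B"] that M(4) unfolding \<A>_def by blast
  then show thesis using M that by blast
qed

text \<open>Ellis-Numakura: in a minimal closed subsemigroup \<open>M\<close> the translate
  \<open>M p\<close> is again a closed subsemigroup, so it is all of \<open>M\<close>. Hence the
  closed subsemigroup of solutions of x p = p is nonempty, and by minimality it contains p
  itself.\<close>

lemma exists_idempotent:
  assumes A: "closedin X A" "A \<noteq> {}" and sub: "\<And>p q. p \<in> A \<Longrightarrow> q \<in> A \<Longrightarrow> m p q \<in> A"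
  obtains p where "p \<in> A" "m p p = p"
proof -
  define P where "P = (\<lambda>B. \<forall>p\<in>B. \<forall>q\<in>B. m p q \<in> B)"
  have "P A" using sub unfolding P_def by auto
  moreover have "P (\<Inter>\<C>)" if "\<C> \<noteq> {}" "\<And>B. B \<in> \<C> \<Longrightarrow> P B" for \<C>
    using that unfolding P_def by blast
  ultimately obtain M where M: "closedin X M" "M \<noteq> {}" "P M" "M \<subseteq> A"
    and min: "\<And>B. closedin X B \<Longrightarrow> B \<noteq> {} \<Longrightarrow> P B \<Longrightarrow> B \<subseteq> M \<Longrightarrow> B = M"
    using exists_minimal_closed[of A P] A by metis
  obtain p where p: "p \<in> M" using M by auto
  have "(\<lambda>x. m x p) ` M = M"
  proof (rule min)
    show "P ((\<lambda>x. m x p) ` M)"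
      unfolding P_def
    proof (intro ballI)
      fix x y assume "x \<in> (\<lambda>x. m x p) ` M" "y \<in> (\<lambda>x. m x p) ` M"
      then obtain a b where ab: "a \<in> M" "x = m a p" "b \<in> M" "y = m b p" by auto
      then have "m x y = m (m (m a p) b) p" by (simp add: assoc)
      then show "m x y \<in> (\<lambda>x. m x p) ` M" using M(3) ab p unfolding P_def by blast
    qed
    show "(\<lambda>x. m x p) ` M \<subseteq> M" using M(3) p unfolding P_def by blast
  qed (use M closedin_translate in auto)
  then have ne: "{x \<in> M. m x p = p} \<noteq> {}" using p by (force simp: image_iff)
  have "{x \<in> M. m x p = p} = M"
  proof (rule min)
    have "closedin X {x \<in> topspace X. m x p \<in> {p}}"
      using continuous hausdorff topspace_UNIV
      by (intro closedin_continuous_map_preimage[of X X]) (auto intro: closedin_Hausdorff_singleton)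
    then show "closedin X {x \<in> M. m x p = p}"
      using M(1) topspace_UNIV closedin_Int by (auto simp: Collect_conj_eq)
    show "P {x \<in> M. m x p = p}" using M(3) by (auto simp: P_def assoc)
  qed (use ne in auto)
  then show thesis using that[of p] p M by auto
qed

text \<open>The witness is an idempotent of a minimal closed left ideal \<open>L\<close> of
  \<open>C\<close>. An idempotent e below p lies in \<open>C p = L\<close>, and
  \<open>C e = L\<close> by minimality, so p = c e for some c; then p e = p, while p e = e by
  assumption.\<close>

lemma exists_minimal_idempotent:
  assumes C: "closedin X C" "C \<noteq> {}" "\<And>p q. p \<in> C \<Longrightarrow> q \<in> C \<Longrightarrow> m p q \<in> C"
  obtains p where "p \<in> C" "m p p = p"
    "\<And>e. e \<in> C \<Longrightarrow> m e e = e \<Longrightarrow> m e p = e \<Longrightarrow> m p e = e \<Longrightarrow> e = p"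
proof -
  define P where "P = (\<lambda>B. B \<subseteq> C \<and> (\<forall>p\<in>C. \<forall>q\<in>B. m p q \<in> B))"
  have "P C" using C unfolding P_def by auto
  moreover have "P (\<Inter>\<C>)" if "\<C> \<noteq> {}" "\<And>B. B \<in> \<C> \<Longrightarrow> P B" for \<C>
    using that unfolding P_def by blast
  ultimately obtain L where L: "closedin X L" "L \<noteq> {}" "P L" "L \<subseteq> C"
    and min: "\<And>B. closedin X B \<Longrightarrow> B \<noteq> {} \<Longrightarrow> P B \<Longrightarrow> B \<subseteq> L \<Longrightarrow> B = L"
    using exists_minimal_closed[of C P] C(1,2) by metis
  obtain p where p: "p \<in> L" "m p p = p"
    using exists_idempotent[of L] L unfolding P_def by blast
  have ideal: "(\<lambda>x. m x e) ` C = L" if "e \<in> L" for e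
  proof (rule min)
    show "P ((\<lambda>x. m x e) ` C)"
      unfolding P_def using C(3) that L(4) by (auto simp: assoc[symmetric])
    show "(\<lambda>x. m x e) ` C \<subseteq> L" using that L(3) unfolding P_def by auto
  qed (use C(1,2) closedin_translate in auto)
  have "e = p" if e: "e \<in> C" "m e e = e" "m e p = e" "m p e = e" for e
  proof -
    have "e \<in> L" using ideal[OF p(1)] e by (metis image_eqI)
    then obtain c where "c \<in> C" "p = m c e" using ideal p(1) by blast
    then have "m p e = p" using e(2) by (simp add: assoc)
    then show ?thesis using e by simp
  qed
  then show thesis using that p L(4) by blast
qed

text \<open>The idempotents behind Carlson-type theorems: \<open>C\<close> plays the constant words, \<open>V\<close> the
  variable words, and \<open>T\<close> the substitutions.\<close>

lemma exists_idempotent_pair: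
  assumes C: "closedin X C" "C \<noteq> {}" "\<And>p q. p \<in> C \<Longrightarrow> q \<in> C \<Longrightarrow> m p q \<in> C"
    and V: "closedin X V" "V \<noteq> {}" "\<And>p q. p \<in> V \<Longrightarrow> q \<in> V \<Longrightarrow> m p q \<in> V"
    and CV: "\<And>p q. p \<in> C \<Longrightarrow> q \<in> V \<Longrightarrow> m p q \<in> V" "\<And>p q. p \<in> C \<Longrightarrow> q \<in> V \<Longrightarrow> m q p \<in> V"
    and T: "\<And>j p q. j \<in> J \<Longrightarrow> T j (m p q) = m (T j p) (T j q)"
      "\<And>j p. j \<in> J \<Longrightarrow> p \<in> C \<Longrightarrow> T j p = p" "\<And>j p. j \<in> J \<Longrightarrow> p \<in> V \<Longrightarrow> T j p \<in> C"
  obtains p q where "p \<in> C" "q \<in> V" "m p p = p" "m q q = q" "m p q = q" "m q p = q"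
    "\<And>j. j \<in> J \<Longrightarrow> T j q = p"
proof -
  obtain p where p: "p \<in> C" "m p p = p"
    and min: "\<And>e. e \<in> C \<Longrightarrow> m e e = e \<Longrightarrow> m e p = e \<Longrightarrow> m p e = e \<Longrightarrow> e = p"
    using exists_minimal_idempotent[of C] C by metis
  \<comment> \<open>Elements of \<open>V p\<close> satisfy r p = r automatically; multiplying by p
    on the left then makes q absorb p on both sides and keeps it idempotent.\<close>
  obtain r where r: "r \<in> (\<lambda>x. m x p) ` V" "m r r = r"
  proof (rule exists_idempotent[of "(\<lambda>x. m x p) ` V"])
    fix x y assume "x \<in> (\<lambda>x. m x p) ` V" "y \<in> (\<lambda>x. m x p) ` V"
    then obtain a b where "a \<in> V" "x = m a p" "b \<in> V" "y = m b p" by auto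
    then have "m x y = m (m (m a p) b) p" by (simp add: assoc)
    moreover have "m (m a p) b \<in> V" using V(3) CV(2) p(1) \<open>a \<in> V\<close> \<open>b \<in> V\<close> by blast
    ultimately show "m x y \<in> (\<lambda>x. m x p) ` V" by blast
  qed (use V(1,2) closedin_translate in auto)
  have rp: "m r p = r" and rV: "r \<in> V" using r(1) p CV(2) by (auto simp: assoc)
  define q where "q = m p r"
  have "m r (m p r) = r" using rp r(2) by (metis assoc)
  moreover have "m p (m p r) = m p r" using p(2) by (metis assoc)
  ultimately have q: "m q q = q" "m p q = q" "m q p = q" "q \<in> V"
    using p(1) CV(1) rp rV unfolding q_def by (simp_all add: assoc)
  have "T j q = p" if "j \<in> J" for j
  proof (rule min)
    show "m (T j q) (T j q) = T j q" using T(1)[OF that, of q q] q(1) by simp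
    show "m (T j q) p = T j q" using T(1)[OF that, of q p] T(2)[OF that p(1)] q(3) by simp
    show "m p (T j q) = T j q" using T(1)[OF that, of p q] T(2)[OF that p(1)] q(2) by simp
  qed (use T(3) that q in auto)
  then show thesis using that p q by blast
qed

end

subsection \<open>Ultrafilters on lists and the pigeonhole principle\<close>

text \<open>The side conditions of \<open>EV\<close> without the demand for a variable, so that
  codes of constant words are available too; \<open>has_var\<close> restores the demand.\<close>

definition index_list :: "(nat \<Rightarrow> nat) \<Rightarrow> (nat \<times> nat) list \<Rightarrow> bool" where
  "index_list k xs \<longleftrightarrow> sorted_wrt (<) (map fst xs) \<and> (\<forall>(n, p)\<in>set xs. 1 \<le> n \<and> p \<le> k n)"

definition has_var :: "(nat \<times> nat) list \<Rightarrow> bool" where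
  "has_var xs \<longleftrightarrow> (\<exists>(n, p)\<in>set xs. p = 0)"

text \<open>Only entries 0 still carry the variable. No minimum with \<open>k\<close> is taken:
  admissibility of the new entries is a separate matter, see
  \<open>index_list_subst\<close>.\<close>

definition list_subst :: "nat \<Rightarrow> (nat \<times> nat) list \<Rightarrow> (nat \<times> nat) list" where
  "list_subst p = map (\<lambda>(n, q). (n, if q = 0 then p else q))"

text \<open>If \<open>f n\<close> codes the n-th term of u over w, this is the code over w of the
  word with code \<open>ys\<close> over u; see \<open>list_word_comp\<close>.\<close>

definition list_comp :: "(nat \<Rightarrow> (nat \<times> nat) list) \<Rightarrow> (nat \<times> nat) list \<Rightarrow> (nat \<times> nat) list" where
  "list_comp f ys = concat (map (\<lambda>(n, p). list_subst p (f n)) ys)"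

lemma index_list_append:
  "index_list k (xs @ ys) \<longleftrightarrow> index_list k xs \<and> index_list k ys \<and>
     (\<forall>i\<in>fst ` set xs. \<forall>j\<in>fst ` set ys. i < j)"
  by (auto simp: index_list_def sorted_wrt_append)

lemma has_var_append [simp]: "has_var (xs @ ys) \<longleftrightarrow> has_var xs \<or> has_var ys"
  by (auto simp: has_var_def)

lemma list_subst_0 [simp]: "list_subst 0 xs = xs"
  by (induction xs) (auto simp: list_subst_def)

lemma fst_set_list_subst [simp]: "fst ` set (list_subst p xs) = fst ` set xs"
  by (force simp: list_subst_def)

lemma map_fst_list_subst [simp]: "map fst (list_subst p xs) = map fst xs"
  by (auto simp: list_subst_def)

lemma list_subst_append: "list_subst p (xs @ ys) = list_subst p xs @ list_subst p ys"
  by (simp add: list_subst_def)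

lemma has_var_list_subst: "has_var (list_subst p xs) \<longleftrightarrow> has_var xs \<and> p = 0"
  by (force simp: list_subst_def has_var_def split: if_splits)

lemma list_subst_no_var: "\<not> has_var xs \<Longrightarrow> list_subst p xs = xs"
  by (induction xs) (auto simp: list_subst_def has_var_def)

lemma index_list_subst:
  assumes "index_list k xs" "\<And>n. n \<in> fst ` set xs \<Longrightarrow> p \<le> k n"
  shows "index_list k (list_subst p xs)"
proof -
  have "1 \<le> n \<and> q \<le> k n" if "(n, q) \<in> set (list_subst p xs)" for n q
    using that assms by (force simp: index_list_def list_subst_def split: if_splits)
  then show ?thesis using assms(1) by (auto simp: index_list_def)
qed

lemma list_comp_Nil [simp]: "list_comp f [] = []"
  by (simp add: list_comp_def)

lemma list_comp_append: "list_comp f (xs @ ys) = list_comp f xs @ list_comp f ys"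
  by (simp add: list_comp_def)

lemma list_comp_Cons: "list_comp f ((n, p) # ys) = list_subst p (f n) @ list_comp f ys"
  by (simp add: list_comp_def)

lemma list_comp_single: "list_comp f [(n, p)] = list_subst p (f n)"
  by (simp add: list_comp_def)

section \<open>Ultrafilters as points of a compact cube\<close>

definition ultra :: "('b set \<Rightarrow> bool) \<Rightarrow> bool" where
  "ultra p \<longleftrightarrow> (\<forall>A. p (- A) \<longleftrightarrow> \<not> p A) \<and> (\<forall>A B. p A \<longrightarrow> A \<subseteq> B \<longrightarrow> p B) \<and>
     (\<forall>A B. p A \<longrightarrow> p B \<longrightarrow> p (A \<inter> B))"

definition ultra_mult :: "('b list set \<Rightarrow> bool) \<Rightarrow> ('b list set \<Rightarrow> bool) \<Rightarrow> 'b list set \<Rightarrow> bool" where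
  "ultra_mult p q A \<longleftrightarrow> p {x. q {y. x @ y \<in> A}}"

definition ultra_map :: "('b \<Rightarrow> 'c) \<Rightarrow> ('b set \<Rightarrow> bool) \<Rightarrow> 'c set \<Rightarrow> bool" where
  "ultra_map f p A \<longleftrightarrow> p (f -` A)"

text \<open>The cube of all predicates on sets, compact by Tychonoff's theorem; the ultrafilters
  form a closed part of it. Products are taken in the whole cube, where associativity and continuity
  already hold, so no separate type of ultrafilters is required.\<close>

definition pred_topology :: "('b set \<Rightarrow> bool) topology" where
  "pred_topology = product_topology (\<lambda>_. discrete_topology UNIV) UNIV"

lemma topspace_pred_topology [simp]: "topspace pred_topology = UNIV"
  by (simp add: pred_topology_def)

interpretation ultra_mult: compact_right_topological_semigroup pred_topology ultra_mult
proof
  show "compact_space pred_topology"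
    by (simp add: pred_topology_def compact_space_product_topology compact_space_discrete_topology)
  show "Hausdorff_space pred_topology"
    by (simp add: pred_topology_def Hausdorff_space_product_topology)
  show "ultra_mult (ultra_mult p q) r = ultra_mult p (ultra_mult q r)" for p q r :: "'b list set \<Rightarrow> bool"
    by (simp add: ultra_mult_def fun_eq_iff)
  show "continuous_map pred_topology pred_topology (\<lambda>p. ultra_mult p q)" for q :: "'b list set \<Rightarrow> bool"
    unfolding pred_topology_def continuous_map_componentwise_UNIV ultra_mult_def
    by (auto intro: continuous_map_product_projection)
qed simp

text \<open>Evaluation at one set is continuous into a discrete space. All closedness proofs below
  are assembled from such conditions on one coordinate.\<close>

lemma closedin_pred_topology: "closedin pred_topology {p. \<Phi> (p A)}"
proof -
  have "continuous_map pred_topology (discrete_topology UNIV) (\<lambda>p. p A)"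
    unfolding pred_topology_def by (rule continuous_map_product_projection) simp
  then have "closedin pred_topology {p \<in> topspace pred_topology. p A \<in> {b. \<Phi> b}}"
    by (intro closedin_continuous_map_preimage) auto
  then show ?thesis by simp
qed

lemma closedin_Collect_all:
  assumes "\<And>i. closedin X {p. \<Phi> i p}" shows "closedin X {p. \<forall>i. \<Phi> i p}"
proof -
  have "{p. \<forall>i. \<Phi> i p} = \<Inter>(range (\<lambda>i. {p. \<Phi> i p}))" by auto
  moreover have "closedin X (\<Inter>(range (\<lambda>i. {p. \<Phi> i p})))"
    by (rule closedin_Inter) (use assms in auto)
  ultimately show ?thesis by simp
qed

lemma closedin_Collect_imp:
  assumes "closedin X {p. \<not> \<Phi> p}" "closedin X {p. \<Psi> p}" shows "closedin X {p. \<Phi> p \<longrightarrow> \<Psi> p}"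
proof -
  have "{p. \<Phi> p \<longrightarrow> \<Psi> p} = {p. \<not> \<Phi> p} \<union> {p. \<Psi> p}" by auto
  then show ?thesis using closedin_Un[OF assms] by simp
qed

lemma closedin_Collect_conj:
  assumes "closedin X {p. \<Phi> p}" "closedin X {p. \<Psi> p}" shows "closedin X {p. \<Phi> p \<and> \<Psi> p}"
proof -
  have "{p. \<Phi> p \<and> \<Psi> p} = {p. \<Phi> p} \<inter> {p. \<Psi> p}" by auto
  then show ?thesis using closedin_Int[OF assms] by simp
qed

lemma closedin_ultra: "closedin pred_topology {p. ultra p}"
proof -
  \<comment> \<open>The equivalence is split into implications, because the closedness rules cover
    implication, conjunction and universal quantification.\<close>
  have "(p (- A) \<longleftrightarrow> \<not> p A) \<longleftrightarrow> (p (- A) \<longrightarrow> \<not> p A) \<and> (\<not> p (- A) \<longrightarrow> p A)"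
    for p and A :: "'a set" by blast
  then show ?thesis
    unfolding ultra_def
    by (simp only:) (intro closedin_Collect_conj closedin_Collect_all closedin_Collect_imp
      closedin_pred_topology closedin_pred_topology[where \<Phi> = Not]
      closedin_pred_topology[where \<Phi> = "\<lambda>b. \<not> \<not> b"] closedin_pred_topology[where \<Phi> = "\<lambda>b. b"])
qed

context
  fixes p :: "'b set \<Rightarrow> bool" assumes p: "ultra p"
begin

lemma ultra_mono: "p A \<Longrightarrow> A \<subseteq> B \<Longrightarrow> p B"
  using p unfolding ultra_def by blast

lemma ultra_Compl: "p (- A) \<longleftrightarrow> \<not> p A"
  using p unfolding ultra_def by blast

lemma ultra_Int: "p (A \<inter> B) \<longleftrightarrow> p A \<and> p B"
  using p unfolding ultra_def by blast

lemma ultra_UNIV: "p UNIV"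
  using ultra_Compl[of UNIV] ultra_mono[of "- UNIV" UNIV] by auto

lemma ultra_not_empty: "p A \<Longrightarrow> A \<noteq> {}"
  using ultra_Compl[of UNIV] ultra_UNIV by auto

lemma ultra_INT: "finite F \<Longrightarrow> (\<And>i. i \<in> F \<Longrightarrow> p (A i)) \<Longrightarrow> p (\<Inter>i\<in>F. A i)"
  by (induction F rule: finite_induct) (auto simp: ultra_Int ultra_UNIV)

lemma ultra_cong: "p B \<Longrightarrow> A \<inter> B = A' \<inter> B \<Longrightarrow> p A \<longleftrightarrow> p A'"
  by (metis ultra_Int)

end

lemma ultra_principal: "ultra (\<lambda>A. x \<in> A)"
  by (auto simp: ultra_def)

lemma ultra_ultra_mult:
  assumes "ultra p" "ultra q" shows "ultra (ultra_mult p q)"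
  unfolding ultra_def ultra_mult_def
proof (intro conjI allI impI)
  fix A B :: "'a list set"
  have "{x. q {y. x @ y \<in> - A}} = - {x. q {y. x @ y \<in> A}}"
  proof -
    have "{y. x @ y \<in> - A} = - {y. x @ y \<in> A}" for x by auto
    then show ?thesis using ultra_Compl[OF assms(2)] by auto
  qed
  then show "p {x. q {y. x @ y \<in> - A}} \<longleftrightarrow> \<not> p {x. q {y. x @ y \<in> A}}"
    using ultra_Compl[OF assms(1)] by simp
next
  fix A B :: "'a list set" assume "p {x. q {y. x @ y \<in> A}}" "A \<subseteq> B"
  then show "p {x. q {y. x @ y \<in> B}}"
    by (elim ultra_mono[OF assms(1)]) (auto elim: ultra_mono[OF assms(2)])
next
  fix A B :: "'a list set" assume "p {x. q {y. x @ y \<in> A}}" "p {x. q {y. x @ y \<in> B}}"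
  then have "p ({x. q {y. x @ y \<in> A}} \<inter> {x. q {y. x @ y \<in> B}})"
    using ultra_Int[OF assms(1)] by auto
  moreover have "{x. q {y. x @ y \<in> A}} \<inter> {x. q {y. x @ y \<in> B}} = {x. q {y. x @ y \<in> A \<inter> B}}"
    using ultra_Int[OF assms(2)] by (auto simp: Collect_conj_eq)
  ultimately show "p {x. q {y. x @ y \<in> A \<inter> B}}" by simp
qed

lemma ultra_ultra_map: "ultra p \<Longrightarrow> ultra (ultra_map f p)"
  unfolding ultra_def ultra_map_def by (auto simp: vimage_Compl vimage_mono)

text \<open>The set \<open>B\<close> may depend on \<open>x\<close>; this allows the second factor
  to start past the end of the first.\<close>

lemma ultra_multI:
  assumes "ultra p" "ultra q" "p A" "\<And>x. x \<in> A \<Longrightarrow> \<exists>B. q B \<and> (\<forall>y\<in>B. x @ y \<in> D)"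
  shows "ultra_mult p q D"
  unfolding ultra_mult_def
proof (rule ultra_mono[OF assms(1,3)], rule subsetI)
  fix x assume "x \<in> A"
  then obtain B where "q B" "\<forall>y\<in>B. x @ y \<in> D" using assms(4) by blast
  then have "B \<subseteq> {y. x @ y \<in> D}" by blast
  then have "q {y. x @ y \<in> D}" by (rule ultra_mono[OF assms(2) \<open>q B\<close>])
  then show "x \<in> {x. q {y. x @ y \<in> D}}" by simp
qed

section \<open>Ultrafilters concentrated on late admissible lists\<close>

definition late :: "nat \<Rightarrow> (nat \<times> nat) list set" where
  "late n = {xs. \<forall>i\<in>fst ` set xs. n \<le> i}"

definition late_ultra :: "(nat \<Rightarrow> nat) \<Rightarrow> ((nat \<times> nat) list set \<Rightarrow> bool) \<Rightarrow> bool" where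
  "late_ultra k p \<longleftrightarrow> ultra p \<and> p {xs. index_list k xs} \<and> (\<forall>n. p (late n))"

lemma closedin_late_ultra: "closedin pred_topology {p. late_ultra k p \<and> p A}"
  unfolding late_ultra_def
  by (intro closedin_Collect_conj closedin_ultra closedin_Collect_all
    closedin_pred_topology[where \<Phi> = "\<lambda>b. b"])

lemma late_ultra_mult:
  assumes "late_ultra k p" "late_ultra k q" shows "late_ultra k (ultra_mult p q)"
proof -
  have p: "ultra p" "p {xs. index_list k xs}" "\<And>n. p (late n)"
    and q: "ultra q" "q {xs. index_list k xs}" "\<And>n. q (late n)"
    using assms unfolding late_ultra_def by auto
  have "ultra_mult p q {xs. index_list k xs}"
  proof (rule ultra_multI[OF p(1) q(1) p(2)])
    fix x assume "x \<in> {xs. index_list k xs}"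
    \<comment> \<open>\<open>n\<close> lies past every index of \<open>x\<close>; inserting 0 covers
      the empty list.\<close>
    moreover define n where "n = Suc (Max (insert 0 (fst ` set x)))"
    have "i < n" if "i \<in> fst ` set x" for i
      unfolding n_def using that by (simp add: less_Suc_eq_le)
    ultimately have "\<forall>y\<in>{xs. index_list k xs} \<inter> late n. x @ y \<in> {xs. index_list k xs}"
      unfolding late_def by (fastforce simp: index_list_append)
    moreover have "q ({xs. index_list k xs} \<inter> late n)" using q ultra_Int[OF q(1)] by blast
    ultimately show "\<exists>B. q B \<and> (\<forall>y\<in>B. x @ y \<in> {xs. index_list k xs})" by blast
  qed
  moreover have "ultra_mult p q (late n)" for n
    by (rule ultra_multI[OF p(1) q(1) p(3)[of n]], rule exI[of _ "late n"])
      (use q(3) in \<open>auto simp: late_def\<close>)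
  ultimately show ?thesis using ultra_ultra_mult[OF p(1) q(1)] unfolding late_ultra_def by simp
qed

text \<open>By monotonicity of \<open>k\<close>, the fixed \<open>j\<close> is admissible at every
  index from \<open>n\<close> on, and almost all lists with respect to \<open>p\<close> use only
  such indices.\<close>

lemma late_ultra_subst:
  assumes "late_ultra k p" "j \<le> k n" and mono: "mono_on {1..} k" and "1 \<le> n"
  shows "late_ultra k (ultra_map (list_subst j) p)"
proof -
  have p: "ultra p" "p {xs. index_list k xs}" "\<And>n. p (late n)"
    using assms unfolding late_ultra_def by auto
  have "j \<le> k i" if "xs \<in> late n" "i \<in> fst ` set xs" for i xs
  proof -
    have "n \<le> i" using that unfolding late_def by blast
    then have "k n \<le> k i" using mono \<open>1 \<le> n\<close> by (intro mono_onD[OF mono]) auto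
    then show ?thesis using assms(2) by simp
  qed
  then have "{xs. index_list k xs} \<inter> late n \<subseteq> list_subst j -` {xs. index_list k xs}"
    by (auto intro: index_list_subst)
  moreover have "p ({xs. index_list k xs} \<inter> late n)" using p ultra_Int[OF p(1)] by blast
  ultimately have "p (list_subst j -` {xs. index_list k xs})" using ultra_mono[OF p(1)] by blast
  moreover have "list_subst j -` late i = late i" for i
    unfolding late_def vimage_def mem_Collect_eq fst_set_list_subst ..
  ultimately show ?thesis
    using ultra_ultra_map[OF p(1)] p(3) unfolding late_ultra_def by (simp add: ultra_map_def)
qed

text \<open>The sets \<open>F n\<close> are closed, decreasing, and nonempty by the principal
  ultrafilter of \<open>[(Suc n, 0)]\<close>; compactness gives a common point.\<close>

lemma exists_late_ultra_has_var: "\<exists>p. late_ultra k p \<and> p {xs. has_var xs}"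
proof -
  define F where "F n = {p. ultra p \<and> p {xs. index_list k xs} \<and> p (late n) \<and> p {xs. has_var xs}}"
    for n
  have "(\<Inter>n. F n) \<noteq> {}"
  proof (rule compact_space_imp_nest[OF ultra_mult.compact])
    show "closedin pred_topology (F n)" for n
      unfolding F_def
      by (intro closedin_Collect_conj closedin_ultra closedin_pred_topology[where \<Phi> = "\<lambda>b. b"])
    have "(\<lambda>A. [(Suc n, 0)] \<in> A) \<in> F n" for n
      unfolding F_def by (simp add: ultra_principal index_list_def has_var_def late_def)
    then show "F n \<noteq> {}" for n by blast
    have "late n \<subseteq> late m" if "m \<le> n" for m n using that unfolding late_def by fastforce
    then show "decseq F" unfolding F_def decseq_def using ultra_mono by blast
  qed
  then show ?thesis unfolding F_def late_ultra_def by blast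
qed

lemma ultra_mult_no_var:
  assumes "ultra p" "ultra q" "p {xs. \<not> has_var xs}" "q {xs. \<not> has_var xs}"
  shows "ultra_mult p q {xs. \<not> has_var xs}"
  by (rule ultra_multI[OF assms(1-3)]) (use assms(4) in auto)

lemma ultra_mult_has_var1:
  assumes "ultra p" "ultra q" "p {xs. has_var xs}" shows "ultra_mult p q {xs. has_var xs}"
  by (rule ultra_multI[OF assms]) (use ultra_UNIV[OF assms(2)] in auto)

lemma ultra_mult_has_var2:
  assumes "ultra p" "ultra q" "q {xs. has_var xs}" shows "ultra_mult p q {xs. has_var xs}"
  by (rule ultra_multI[OF assms(1,2) ultra_UNIV[OF assms(1)]]) (use assms(3) in auto)

lemma exists_idempotent_ultra_pair:
  assumes mono: "mono_on {1..} k"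
  obtains p q where "late_ultra k p" "late_ultra k q" "p {xs. \<not> has_var xs}" "q {xs. has_var xs}"
    "ultra_mult p p = p" "ultra_mult q q = q" "ultra_mult p q = q" "ultra_mult q p = q"
    "\<And>n j. 1 \<le> n \<Longrightarrow> 1 \<le> j \<Longrightarrow> j \<le> k n \<Longrightarrow> ultra_map (list_subst j) q = p"
proof -
  define C where "C = {p. late_ultra k p \<and> p {xs. \<not> has_var xs}}"
  define V where "V = {p. late_ultra k p \<and> p {xs. has_var xs}}"
  have lu: "late_ultra k p \<Longrightarrow> ultra p" for p by (simp add: late_ultra_def)
  show thesis
  \<comment> \<open>The substitutions considered are those \<open>j\<close> that are admissible at
    some index, hence at all later ones.\<close>
  proof (rule ultra_mult.exists_idempotent_pair[of C V "{j. 1 \<le> j \<and> (\<exists>n\<ge>1. j \<le> k n)}"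
        "\<lambda>j. ultra_map (list_subst j)"])
    show "closedin pred_topology C" "closedin pred_topology V"
      unfolding C_def V_def by (rule closedin_late_ultra)+
    \<comment> \<open>The empty list is vacuously late and has no variable.\<close>
    have "(\<lambda>A. [] \<in> A) \<in> C"
      unfolding C_def late_ultra_def by (simp add: ultra_principal index_list_def has_var_def late_def)
    then show "C \<noteq> {}" by blast
    show "V \<noteq> {}" using exists_late_ultra_has_var unfolding V_def by blast
    show "ultra_mult p q \<in> C" if "p \<in> C" "q \<in> C" for p q
      using that unfolding C_def by (simp add: late_ultra_mult lu ultra_mult_no_var)
    show "ultra_mult p q \<in> V" if "p \<in> V" "q \<in> V" for p q
      using that unfolding V_def by (simp add: late_ultra_mult lu ultra_mult_has_var1)
    show "ultra_mult p q \<in> V" if "p \<in> C" "q \<in> V" for p q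
      using that unfolding V_def C_def by (simp add: late_ultra_mult lu ultra_mult_has_var2)
    show "ultra_mult q p \<in> V" if "p \<in> C" "q \<in> V" for p q
      using that unfolding V_def C_def by (simp add: late_ultra_mult lu ultra_mult_has_var1)
    show "ultra_map (list_subst j) (ultra_mult p q) =
        ultra_mult (ultra_map (list_subst j) p) (ultra_map (list_subst j) q)" for j p q
      by (simp add: fun_eq_iff ultra_mult_def ultra_map_def list_subst_append vimage_def)
    show "ultra_map (list_subst j) p = p" if "p \<in> C" for j p
    proof
      fix A
      have "ultra p" "p {xs. \<not> has_var xs}" using that lu unfolding C_def by auto
      then show "ultra_map (list_subst j) p A \<longleftrightarrow> p A"
        unfolding ultra_map_def by (rule ultra_cong) (auto simp: list_subst_no_var)
    qed
    show "ultra_map (list_subst j) p \<in> C"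
      if "j \<in> {j. 1 \<le> j \<and> (\<exists>n\<ge>1. j \<le> k n)}" "p \<in> V" for j p
    proof -
      have "late_ultra k (ultra_map (list_subst j) p)"
        using that late_ultra_subst[OF _ _ mono] unfolding V_def by blast
      moreover have "ultra p" using that lu unfolding V_def by auto
      moreover have "list_subst j -` {xs. \<not> has_var xs} = UNIV"
        using that by (auto simp: has_var_list_subst)
      ultimately show ?thesis unfolding C_def by (simp add: ultra_map_def ultra_UNIV)
    qed
  next
    fix p q
    assume "p \<in> C" "q \<in> V" "ultra_mult p p = p" "ultra_mult q q = q"
      "ultra_mult p q = q" "ultra_mult q p = q"
      "\<And>j. j \<in> {j. 1 \<le> j \<and> (\<exists>n\<ge>1. j \<le> k n)} \<Longrightarrow> ultra_map (list_subst j) q = p"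
    then show thesis using that[of p q] unfolding C_def V_def by auto
  qed
qed

section \<open>Block sequences inside a member of the idempotent q\<close>

definition residual :: "'b list \<Rightarrow> 'b list set \<Rightarrow> 'b list set" where
  "residual z A = {y. z @ y \<in> A}"

lemma mem_residual: "x \<in> residual z A \<longleftrightarrow> z @ x \<in> A"
  by (simp add: residual_def)

lemma residual_append: "residual (z @ x) A = residual x (residual z A)"
  by (simp add: residual_def)

lemma ultra_mult_residual: "ultra_mult p q A \<longleftrightarrow> p {x. q (residual x A)}"
  by (simp add: ultra_mult_def residual_def)

text \<open>The Galvin-Glazer construction known from Hindman's theorem: the next block is taken
  from a finite intersection of members of q, one for each product z of earlier blocks and each
  substitution j. For j > 0 these sets belong to q because \<open>list_subst j\<close> maps q to
  p.\<close>

lemma variable_list_sequence: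
  assumes pq: "late_ultra k p" "late_ultra k q" "p {xs. \<not> has_var xs}" "q {xs. has_var xs}"
      "ultra_mult p p = p" "ultra_mult q q = q" "ultra_mult p q = q" "ultra_mult q p = q"
      "\<And>n j. 1 \<le> n \<Longrightarrow> 1 \<le> j \<Longrightarrow> j \<le> k n \<Longrightarrow> ultra_map (list_subst j) q = p"
    and A: "q A"
  shows "\<exists>f. (\<forall>n\<ge>1. index_list k (f n) \<and> has_var (f n) \<and>
      (\<forall>i\<in>fst ` set (f n). \<forall>j\<in>fst ` set (f (Suc n)). i < j)) \<and>
      (\<forall>ys. index_list k ys \<and> has_var ys \<longrightarrow> list_comp f ys \<in> A)"
proof -
  have u: "ultra p" "ultra q" and lq: "q {xs. index_list k xs}" "\<And>n. q (late n)"
    using pq(1,2) unfolding late_ultra_def by auto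
  \<comment> \<open>A product without variable need not lie in \<open>A\<close> yet, but must be
    extendable by variable blocks, hence q; once a variable has occurred, constant blocks may
    complete the word, hence p.\<close>
  define good where "good z \<longleftrightarrow> q (residual z A) \<and> (has_var z \<longrightarrow> z \<in> A \<and> p (residual z A))" for z
  have good_Nil: "good []" using A by (simp add: good_def residual_def has_var_def)
  \<comment> \<open>q q = q and q p = q make both residuals large again; membership of
    \<open>x\<close> in \<open>residual z A\<close> puts \<open>z @ x\<close> into
    \<open>A\<close>.\<close>
  have q1: "q {x. good (z @ x)}" if "good z" for z
  proof -
    have qz: "q (residual z A)" using that unfolding good_def by simp
    have "q {x. q (residual x (residual z A))}" "q {x. p (residual x (residual z A))}"
      using qz pq(6,8) by (metis ultra_mult_residual)+
    then have "q ({x. q (residual x (residual z A))} \<inter> {x. p (residual x (residual z A))} \<inter> residual z A)"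
      using qz ultra_Int[OF u(2)] by blast
    then show ?thesis
      by (rule ultra_mono[OF u(2)]) (auto simp: good_def residual_append mem_residual)
  qed
  have p1: "p {x. good (z @ x)}" if "good z" for z
  \<comment> \<open>With a variable in \<open>z\<close>, p p = p and p q = q apply. Without one only
    p q = q is available, and \<open>x\<close> is taken constant so that the second half of
    \<open>good\<close> is vacuous.\<close>
  proof (cases "has_var z")
    case True
    then have qz: "q (residual z A)" "p (residual z A)" using that unfolding good_def by auto
    have "p {x. q (residual x (residual z A))}" "p {x. p (residual x (residual z A))}"
      using qz pq(5,7) by (metis ultra_mult_residual)+
    then have "p ({x. q (residual x (residual z A))} \<inter> {x. p (residual x (residual z A))} \<inter> residual z A)"
      using qz ultra_Int[OF u(1)] by blast
    then show ?thesis
      by (rule ultra_mono[OF u(1)]) (auto simp: good_def residual_append mem_residual)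
  next
    case False
    have "q (residual z A)" using that unfolding good_def by auto
    then have "p {x. q (residual x (residual z A))}" using pq(7) by (metis ultra_mult_residual)
    moreover have "p {x. \<not> has_var x}" using pq(3) .
    ultimately have "p ({x. q (residual x (residual z A))} \<inter> {x. \<not> has_var x})"
      using ultra_Int[OF u(1)] by blast
    then show ?thesis
      by (rule ultra_mono[OF u(1)]) (use False in \<open>auto simp: good_def residual_append\<close>)
  qed
  have qj: "q {x. good (z @ list_subst j x)}" if "good z" "j \<le> k n" "1 \<le> n" for z j n
  proof (cases "j = 0")
    case False
    then have "ultra_map (list_subst j) q = p" using pq(9) that by auto
    then have "ultra_map (list_subst j) q {x. good (z @ x)}" using p1[OF that(1)] by simp
    then show ?thesis by (simp add: ultra_map_def vimage_def)
  qed (use q1 that in auto)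
  \<comment> \<open>\<open>Z\<close> collects the products of the blocks chosen so far,
    \<open>x\<close> is the latest block. Stage 0 carries the dummy block \<open>[]\<close>, since
    blocks are counted from 1.\<close>
  define P where "P = (\<lambda>n::nat. \<lambda>(Z, x). finite Z \<and> [] \<in> Z \<and> (\<forall>z\<in>Z. good z) \<and>
    (n \<ge> 1 \<longrightarrow> index_list k x \<and> has_var x))"
  define Q where "Q = (\<lambda>n. \<lambda>(Z, x :: (nat \<times> nat) list) (Z', x'). (\<forall>i\<in>fst ` set x. \<forall>j\<in>fst ` set x'. i < j) \<and>
    Z' = Z \<union> (\<lambda>(z, j). z @ list_subst j x') ` (Z \<times> {..k (Suc n)}))"
  have "\<exists>s. \<forall>n. P n (s n) \<and> Q n (s n) (s (Suc n))"
  proof (rule dependent_nat_choice)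
    show "\<exists>s. P 0 s" using good_Nil by (intro exI[of _ "({[]}, [])"]) (simp add: P_def)
  next
    fix s n assume Ps: "P n s"
    obtain Z x where s: "s = (Z, x)" by fastforce
    have Z: "finite Z" "[] \<in> Z" "\<And>z. z \<in> Z \<Longrightarrow> good z" using Ps unfolding P_def s by auto
    define N where "N = Suc (Max (insert 0 (fst ` set x)))"
    have N: "i < N" if "i \<in> fst ` set x" for i
      unfolding N_def using that by (simp add: less_Suc_eq_le)
    have "q (\<Inter>(z, j)\<in>Z \<times> {..k (Suc n)}. {x. good (z @ list_subst j x)})"
      by (rule ultra_INT[OF u(2)]) (use Z qj[of _ _ "Suc n"] in auto)
    then have "q ((\<Inter>(z, j)\<in>Z \<times> {..k (Suc n)}. {x. good (z @ list_subst j x)}) \<inter>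
        {xs. index_list k xs} \<inter> late N \<inter> {xs. has_var xs})"
      using ultra_Int[OF u(2)] lq pq(4) by blast
    then obtain x' where x': "x' \<in> (\<Inter>(z, j)\<in>Z \<times> {..k (Suc n)}. {x. good (z @ list_subst j x)})"
      "index_list k x'" "x' \<in> late N" "has_var x'"
      using ultra_not_empty[OF u(2)] by blast
    define Z' where "Z' = Z \<union> (\<lambda>(z, j). z @ list_subst j x') ` (Z \<times> {..k (Suc n)})"
    have "P (Suc n) (Z', x')" using Z x' unfolding P_def Z'_def by auto
    moreover have "i < j" if "i \<in> fst ` set x" "j \<in> fst ` set x'" for i j
      using N[OF that(1)] x'(3) that(2) unfolding late_def by fastforce
    then have "Q n s (Z', x')" unfolding Q_def s Z'_def by simp
    ultimately show "\<exists>s'. P (Suc n) s' \<and> Q n s s'" by blast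
  qed
  then obtain s where Ps: "\<And>n. P n (s n)" and Qs: "\<And>n. Q n (s n) (s (Suc n))" by blast
  define f where "f n = snd (s n)" for n
  define Z where "Z n = fst (s n)" for n
  have Z: "[] \<in> Z n" "\<And>z. z \<in> Z n \<Longrightarrow> good z" for n
    using Ps[of n] unfolding P_def Z_def by (auto simp: case_prod_unfold)
  have Z_Suc: "Z (Suc n) = Z n \<union> (\<lambda>(z, j). z @ list_subst j (f (Suc n))) ` (Z n \<times> {..k (Suc n)})" for n
    using Qs[of n] unfolding Q_def Z_def f_def by (auto simp: case_prod_unfold)
  have Z_mono: "Z m \<subseteq> Z n" if "m \<le> n" for m n
    using lift_Suc_mono_le[of Z m n] Z_Suc that by blast
  \<comment> \<open>Induction from the right: the last entry decides the stage, and the remaining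
    entries have smaller indices.\<close>
  have "list_comp f ys \<in> Z N" if "index_list k ys" "\<And>i. i \<in> fst ` set ys \<Longrightarrow> i \<le> N" for ys N
    using that
  proof (induction ys arbitrary: N rule: rev_induct)
    case (snoc a ys)
    obtain n j where a: "a = (n, j)" by fastforce
    have n: "n \<ge> 1" "j \<le> k n" "n \<le> N" using snoc.prems unfolding a index_list_append
      by (auto simp: index_list_def)
    then obtain m where m: "n = Suc m" by (cases n) auto
    have "index_list k ys" "\<And>i. i \<in> fst ` set ys \<Longrightarrow> i \<le> m"
      using snoc.prems(1) unfolding index_list_append a m by (auto simp: less_Suc_eq_le)
    then have "list_comp f ys \<in> Z m" by (rule snoc.IH)
    then have "list_comp f (ys @ [a]) \<in> Z n"
      using n(2) unfolding m Z_Suc list_comp_append a list_comp_single by auto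
    then show ?case using Z_mono[OF n(3)] by blast
  qed (use Z in simp)
  note inZ = this
  have hv: "has_var (f n)" if "n \<ge> 1" for n
    using Ps[of n] that unfolding P_def f_def by (auto simp: case_prod_unfold)
  have "list_comp f ys \<in> A" if ys: "index_list k ys" "has_var ys" for ys
  proof -
    have "list_comp f ys \<in> Z (Max (insert 0 (fst ` set ys)))"
      by (rule inZ[OF ys(1)]) simp
    then have "good (list_comp f ys)" using Z by blast
    moreover have "has_var (list_comp f ys)"
    proof -
      obtain n where n: "(n, 0) \<in> set ys" using ys(2) unfolding has_var_def by auto
      then have "n \<ge> 1" using ys(1) unfolding index_list_def by auto
      then obtain i where "(i, 0) \<in> set (f n)" using hv unfolding has_var_def by fastforce
      then have "(i, 0) \<in> set (list_comp f ys)" unfolding list_comp_def using n by force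
      then show ?thesis unfolding has_var_def by force
    qed
    ultimately show ?thesis unfolding good_def by simp
  qed
  moreover have "index_list k (f n) \<and> has_var (f n) \<and>
      (\<forall>i\<in>fst ` set (f n). \<forall>j\<in>fst ` set (f (Suc n)). i < j)" if "n \<ge> 1" for n
    using Ps[of n] Qs[of n] that unfolding P_def Q_def f_def by (auto simp: case_prod_unfold)
  ultimately show ?thesis by blast
qed

text \<open>The ultrafilter q contains one colour class or its complement, and the block sequence is
  built inside that one.\<close>

theorem variable_list_pigeonhole:
  assumes mono: "mono_on {1..} k"
  obtains f where "\<And>n. 1 \<le> n \<Longrightarrow> index_list k (f n)" "\<And>n. 1 \<le> n \<Longrightarrow> has_var (f n)"
    "\<And>n i j. 1 \<le> n \<Longrightarrow> i \<in> fst ` set (f n) \<Longrightarrow> j \<in> fst ` set (f (Suc n)) \<Longrightarrow> i < j"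
    "(\<forall>ys. index_list k ys \<and> has_var ys \<longrightarrow> P (list_comp f ys)) \<or>
     (\<forall>ys. index_list k ys \<and> has_var ys \<longrightarrow> \<not> P (list_comp f ys))"
proof -
  obtain p q where pq: "late_ultra k p" "late_ultra k q" "p {xs. \<not> has_var xs}" "q {xs. has_var xs}"
      "ultra_mult p p = p" "ultra_mult q q = q" "ultra_mult p q = q" "ultra_mult q p = q"
      "\<And>n j. 1 \<le> n \<Longrightarrow> 1 \<le> j \<Longrightarrow> j \<le> k n \<Longrightarrow> ultra_map (list_subst j) q = p"
    using exists_idempotent_ultra_pair[OF mono] by metis
  define A where "A = (if q {x. P x} then {x. P x} else - {x. P x})"
  have "q A" using pq(2) ultra_Compl[of q "{x. P x}"] unfolding A_def late_ultra_def by simp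
  have "\<exists>f. (\<forall>n\<ge>1. index_list k (f n) \<and> has_var (f n) \<and>
      (\<forall>i\<in>fst ` set (f n). \<forall>j\<in>fst ` set (f (Suc n)). i < j)) \<and>
      (\<forall>ys. index_list k ys \<and> has_var ys \<longrightarrow> list_comp f ys \<in> A)"
    by (rule variable_list_sequence[OF pq(1-8)]) (use pq(9) \<open>q A\<close> in auto)
  then obtain f where f: "\<forall>n\<ge>1. index_list k (f n) \<and> has_var (f n) \<and>
      (\<forall>i\<in>fst ` set (f n). \<forall>j\<in>fst ` set (f (Suc n)). i < j)"
    "\<forall>ys. index_list k ys \<and> has_var ys \<longrightarrow> list_comp f ys \<in> A"
    by blast
  have "(\<forall>ys. index_list k ys \<and> has_var ys \<longrightarrow> P (list_comp f ys)) \<or>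
     (\<forall>ys. index_list k ys \<and> has_var ys \<longrightarrow> \<not> P (list_comp f ys))"
    using f(2) unfolding A_def by (auto split: if_splits)
  then show thesis using that[of f] f(1) by blast
qed

subsection \<open>Located words\<close>

definition list_word ::
  "(nat \<Rightarrow> 'a) \<Rightarrow> (nat \<Rightarrow> nat) \<Rightarrow> 'a \<Rightarrow> (nat \<Rightarrow> 'a word) \<Rightarrow> (nat \<times> nat) list \<Rightarrow> 'a word" where
  "list_word alpha k v w xs = foldr (++) (map (\<lambda>(n, p). subst alpha k v p (w n)) xs) Map.empty"

text \<open>The restriction keeps the value at 0 undefined, as membership in
  \<open>word_seqs\<close> requires.\<close>

definition tail_seq :: "nat \<Rightarrow> (nat \<Rightarrow> 'b) \<Rightarrow> nat \<Rightarrow> 'b" where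
  "tail_seq m w = restrict (\<lambda>i. w (m + i)) {1..}"

definition after :: "'a word list \<Rightarrow> 'a word \<Rightarrow> bool" where
  "after t y \<longleftrightarrow> t = [] \<or> word_less (last t) y"

lemma EV_eq: "EV alpha k v w = {list_word alpha k v w xs | xs. index_list k xs \<and> has_var xs}"
  unfolding EV_def list_word_def index_list_def has_var_def by (simp add: conj_assoc)

lemma tail_seq_apply: "1 \<le> i \<Longrightarrow> tail_seq m w i = w (m + i)"
  by (simp add: tail_seq_def)

lemma subst_0 [simp]: "subst alpha k v 0 x = x"
  by (simp add: subst_def)

lemma dom_subst [simp]: "dom (subst alpha k v p x) = dom x"
  by (auto simp: subst_def split: if_splits)

lemma subst_append: "subst alpha k v p (x ++ y) = subst alpha k v p x ++ subst alpha k v p y"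
  by (auto simp: subst_def map_add_def fun_eq_iff split: option.splits)

lemma subst_empty [simp]: "subst alpha k v p Map.empty = Map.empty"
  by (auto simp: subst_def)

lemma list_word_Nil [simp]: "list_word alpha k v w [] = Map.empty"
  by (simp add: list_word_def)

lemma list_word_Cons:
  "list_word alpha k v w ((n, p) # xs) = subst alpha k v p (w n) ++ list_word alpha k v w xs"
  by (simp add: list_word_def)

lemma list_word_append:
  "list_word alpha k v w (xs @ ys) = list_word alpha k v w xs ++ list_word alpha k v w ys"
  by (induction xs) (auto simp: list_word_Cons)

lemma list_word_single: "list_word alpha k v w [(n, 0)] = w n"
  by (simp add: list_word_Cons)

lemma dom_list_word: "dom (list_word alpha k v w xs) = (\<Union>n\<in>fst ` set xs. dom (w n))"
proof (induction xs)
  case (Cons a xs)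
  then show ?case by (cases a) (simp add: list_word_Cons Un_commute)
qed simp

lemma list_word_cong:
  "(\<And>n. n \<in> fst ` set xs \<Longrightarrow> w n = w' n) \<Longrightarrow> list_word alpha k v w xs = list_word alpha k v w' xs"
  by (induction xs) (auto simp: list_word_Cons)

lemma list_word_SomeD:
  "list_word alpha k v w xs a = Some c \<Longrightarrow> \<exists>(n, p)\<in>set xs. subst alpha k v p (w n) a = Some c"
  by (induction xs) (auto simp: list_word_Cons)

lemma has_var_not_Nil: "has_var xs \<Longrightarrow> xs \<noteq> []"
  by (auto simp: has_var_def)

lemma index_list_ge_1: "index_list k xs \<Longrightarrow> i \<in> fst ` set xs \<Longrightarrow> 1 \<le> i"
  by (auto simp: index_list_def)

lemma index_list_single [simp]: "index_list k [(n, p)] \<longleftrightarrow> 1 \<le> n \<and> p \<le> k n"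
  by (simp add: index_list_def)

lemma has_var_single [simp]: "has_var [(n, p)] \<longleftrightarrow> p = 0"
  by (simp add: has_var_def)

section \<open>Initial segments of sequences\<close>

definition prefix :: "nat \<Rightarrow> (nat \<Rightarrow> 'b) \<Rightarrow> 'b list" where
  "prefix n x = map x [1..<Suc n]"

lemma length_prefix [simp]: "length (prefix n x) = n"
  by (simp add: prefix_def)

lemma init_seg_prefix: "init_seg (prefix n x) x"
  by (simp add: init_seg_def prefix_def del: upt_Suc)

lemma prefix_append:
  assumes "m \<le> n" shows "prefix n x = prefix m x @ map x [Suc m..<Suc n]"
proof -
  have "[1..<Suc m + (n - m)] = [1..<Suc m] @ [Suc m..<Suc m + (n - m)]"
    by (rule upt_add_eq_append) simp
  then show ?thesis using assms unfolding prefix_def by (simp del: upt_Suc)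
qed

lemma init_seg_iff_prefix: "init_seg t x \<longleftrightarrow> t = prefix (length t) x"
proof
  assume "init_seg t x"
  then show "t = prefix (length t) x"
    by (intro nth_equalityI) (simp_all add: init_seg_def prefix_def del: upt_Suc)
next
  assume "t = prefix (length t) x"
  then show "init_seg t x" using init_seg_prefix[of "length t" x] by simp
qed

locale located_words =
  fixes alpha :: "nat \<Rightarrow> 'a" and k :: "nat \<Rightarrow> nat" and v :: 'a
  assumes v_notin: "v \<notin> alpha ` {1..}"
    and k_pos: "\<And>n. 1 \<le> n \<Longrightarrow> 1 \<le> k n"
    and k_mono: "mono_on {1..} k"
begin

abbreviation "W \<equiv> words alpha k v"
abbreviation "R \<equiv> word_seqs alpha k v"
abbreviation "tuples \<equiv> word_tuples alpha k v"
abbreviation "E \<equiv> EV alpha k v"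
abbreviation "lw \<equiv> list_word alpha k v"
abbreviation "basic \<equiv> basic_set alpha k v"
abbreviation prec (infix "\<lhd>" 50) where "u \<lhd> w \<equiv> ev_prec alpha k v u w"

lemma k_le: "1 \<le> m \<Longrightarrow> m \<le> n \<Longrightarrow> k m \<le> k n"
  using k_mono by (auto intro: mono_onD)

text \<open>A letter put in by a positive \<open>q\<close> is some \<open>alpha i\<close> with i
  \<ge> 1, hence differs from \<open>v\<close> and is immune to the second substitution. The
  assumption on the domain gives \<open>1 \<le> k n\<close>, which excludes
  \<open>alpha 0\<close>.\<close>

lemma subst_subst:
  assumes "dom x \<subseteq> {1..}"
  shows "subst alpha k v p (subst alpha k v q x) = subst alpha k v (if q = 0 then p else q) x"
proof (cases "q = 0")
  case False
  have "alpha (min q (k n)) \<noteq> v" if "x n = Some v" for n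
  proof -
    have "1 \<le> n" using that assms by auto
    then have "min q (k n) \<in> {1..}" using False k_pos by (auto simp: Suc_le_eq)
    then show ?thesis using v_notin by blast
  qed
  then show ?thesis using False by (auto simp: subst_def fun_eq_iff)
qed simp

lemma subst_list_word:
  assumes "\<And>n. n \<in> fst ` set xs \<Longrightarrow> dom (w n) \<subseteq> {1..}"
  shows "subst alpha k v p (lw w xs) = lw w (list_subst p xs)"
  using assms
proof (induction xs)
  case (Cons a xs)
  obtain n q where a: "a = (n, q)" by fastforce
  have "subst alpha k v p (lw w xs) = lw w (list_subst p xs)"
    using Cons by auto
  moreover have "dom (w n) \<subseteq> {1..}" using Cons.prems a by auto
  ultimately show ?case
    by (auto simp: a list_word_Cons subst_append subst_subst list_subst_def)
qed (simp add: list_subst_def)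

text \<open>The link between words and codes: it carries both the transitivity of \<lhd> and the
  pigeonhole principle from lists to words.\<close>

lemma list_word_comp:
  assumes "\<And>n. n \<in> fst ` set ys \<Longrightarrow> u n = lw w (f n)"
    and "\<And>n i. n \<in> fst ` set ys \<Longrightarrow> i \<in> fst ` set (f n) \<Longrightarrow> dom (w i) \<subseteq> {1..}"
  shows "lw u ys = lw w (list_comp f ys)"
  using assms
proof (induction ys)
  case (Cons a ys)
  obtain n q where a: "a = (n, q)" by fastforce
  have "lw u ys = lw w (list_comp f ys)"
  proof (rule Cons.IH)
    show "u m = lw w (f m)" if "m \<in> fst ` set ys" for m
      using Cons.prems(1)[of m] that by simp
    show "dom (w i) \<subseteq> {1..}" if "m \<in> fst ` set ys" "i \<in> fst ` set (f m)" for m i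
      using Cons.prems(2)[of m i] that by simp
  qed
  moreover have "u n = lw w (f n)" using Cons.prems(1)[of n] a by simp
  moreover have "subst alpha k v q (lw w (f n)) = lw w (list_subst q (f n))"
    using Cons.prems(2) a by (intro subst_list_word) auto
  ultimately show ?case by (simp add: a list_word_Cons list_comp_Cons list_word_append)
qed simp

lemma wordsD:
  assumes "x \<in> W" shows "finite (dom x)" "dom x \<noteq> {}" "dom x \<subseteq> {1..}"
  using assms by (auto simp: words_def)

lemma word_less_iff:
  assumes "x \<in> W" "y \<in> W" shows "word_less x y \<longleftrightarrow> (\<forall>a\<in>dom x. \<forall>b\<in>dom y. a < b)"
  unfolding word_less_def using wordsD[OF assms(1)] wordsD[OF assms(2)]
  by (simp add: Max_less_iff Min_gr_iff) blast

lemma word_less_irrefl: "x \<in> W \<Longrightarrow> \<not> word_less x x"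
  using wordsD(2) by (fastforce simp: word_less_iff)

lemma word_less_trans:
  assumes "x \<in> W" "y \<in> W" "z \<in> W" "word_less x y" "word_less y z" shows "word_less x z"
proof -
  obtain c where c: "c \<in> dom y" using wordsD(2)[OF assms(2)] by blast
  have "a < b" if "a \<in> dom x" "b \<in> dom z" for a b
  proof -
    have "a < c" using assms(4) c that(1) by (simp add: word_less_iff[OF assms(1,2)])
    also have "c < b" using assms(5) c that(2) by (simp add: word_less_iff[OF assms(2,3)])
    finally show ?thesis .
  qed
  then show ?thesis by (simp add: word_less_iff[OF assms(1,3)])
qed

lemma seq_word: "w \<in> R \<Longrightarrow> 1 \<le> n \<Longrightarrow> w n \<in> W"
  by (auto simp: word_seqs_def PiE_iff)

lemma seqI:
  assumes "\<And>n. 1 \<le> n \<Longrightarrow> w n \<in> W" "\<And>n. 1 \<le> n \<Longrightarrow> word_less (w n) (w (Suc n))" "w 0 = undefined"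
  shows "w \<in> R"
proof -
  have "w n = undefined" if "n \<notin> {1..}" for n using that assms(3) by (cases n) auto
  then show ?thesis
    unfolding word_seqs_def PiE_iff extensional_def using assms by auto
qed

lemma seq_word_less:
  assumes "w \<in> R" "1 \<le> i" "i < j" shows "word_less (w i) (w j)"
  using assms(3)
proof (induction j)
  case (Suc j)
  have step: "word_less (w n) (w (Suc n))" if "1 \<le> n" for n
    using assms(1) that by (auto simp: word_seqs_def)
  show ?case
  proof (cases "i = j")
    case False
    then have "i < j" "1 \<le> j" using Suc.prems assms(2) by auto
    then show ?thesis
      using word_less_trans[of "w i" "w j" "w (Suc j)"] Suc.IH step seq_word[OF assms(1)] assms(2)
      by simp
  qed (use step assms(2) in auto)
qed simp

lemma seq_less:
  assumes "w \<in> R" "1 \<le> i" "i < j" "a \<in> dom (w i)" "b \<in> dom (w j)" shows "a < b"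
  using seq_word_less[OF assms(1-3)] seq_word[OF assms(1)] assms by (simp add: word_less_iff)

text \<open>Each term lies strictly to the right of its predecessor. The bound serves to push a
  sequence past a given position by shifting its index.\<close>

lemma seq_index_le:
  assumes "w \<in> R" "1 \<le> n" "a \<in> dom (w n)" shows "n \<le> a"
  using assms(2,3)
proof (induction n arbitrary: a rule: dec_induct)
  case base
  then show ?case using wordsD(3)[OF seq_word[OF assms(1), of 1]] by auto
next
  case (step n)
  obtain b where "b \<in> dom (w n)" using wordsD(2)[OF seq_word[OF assms(1) step(1)]] by blast
  then show ?case using step.IH[of b] seq_less[OF assms(1) step(1), of "Suc n" b a] step.prems by simp
qed

text \<open>The terms of \<open>w\<close> have disjoint domains, so \<open>++\<close> never
  overrides a value.\<close>

lemma list_word_apply: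
  assumes w: "w \<in> R" and "index_list k xs" "(n, p) \<in> set xs" "a \<in> dom (w n)"
  shows "lw w xs a = subst alpha k v p (w n) a"
  using assms(2-)
proof (induction xs)
  case (Cons x xs)
  obtain m q where x: "x = (m, q)" by fastforce
  have xs: "index_list k xs" and 1: "1 \<le> m" "1 \<le> n" and lt: "\<And>i. i \<in> fst ` set xs \<Longrightarrow> m < i"
    using Cons.prems unfolding x index_list_def by auto
  show ?case
  proof (cases "(n, p) \<in> set xs")
    case True
    then have "lw w xs a = subst alpha k v p (w n) a" using Cons.IH xs Cons.prems(3) by blast
    moreover have "a \<in> dom (subst alpha k v p (w n))" using Cons.prems(3) by simp
    then obtain c where "subst alpha k v p (w n) a = Some c" by blast
    ultimately show ?thesis unfolding x list_word_Cons map_add_def by simp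
  next
    case False
    then have "n = m" "p = q" using Cons.prems x by auto
    have "a \<notin> dom (w i)" if "i \<in> fst ` set xs" for i
      using seq_less[OF w 1(1) lt[OF that], of a a] Cons.prems(3) \<open>n = m\<close> by blast
    then have "a \<notin> dom (lw w xs)" unfolding dom_list_word by blast
    then show ?thesis unfolding x list_word_Cons map_add_def \<open>n = m\<close> \<open>p = q\<close> by (auto split: option.splits)
  qed
qed simp

lemma list_word_in_words:
  assumes w: "w \<in> R" and xs: "index_list k xs" "has_var xs" shows "lw w xs \<in> W"
proof -
  have ge: "1 \<le> n" if "n \<in> fst ` set xs" for n using index_list_ge_1 xs(1) that by blast
  have wn: "w n \<in> W" if "n \<in> fst ` set xs" for n using seq_word[OF w ge[OF that]] .
  obtain n where n: "(n, 0) \<in> set xs" using xs(2) unfolding has_var_def by auto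
  then have n': "n \<in> fst ` set xs" by force
  have fin: "finite (dom (lw w xs))" "dom (lw w xs) \<subseteq> {1..}"
    unfolding dom_list_word using wordsD(1,3)[OF wn] by blast+
  moreover have "dom (lw w xs) \<noteq> {}"
    unfolding dom_list_word using wordsD(2)[OF wn[OF n']] n' by blast
  moreover have "the (lw w xs a) \<in> insert v (alpha ` {1..k a})" if a: "a \<in> dom (lw w xs)" for a
  proof -
    obtain c where c: "lw w xs a = Some c" using a by auto
    then obtain m p where m: "(m, p) \<in> set xs" "subst alpha k v p (w m) a = Some c"
      using list_word_SomeD by fastforce
    have a1: "1 \<le> a" using a fin(2) by auto
    then have "1 \<le> k a" by (rule k_pos)
    have "m \<in> fst ` set xs" using m by force
    moreover have "a \<in> dom (w m)" using m(2) dom_subst by (metis domI)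
    ultimately have "the (w m a) \<in> insert v (alpha ` {1..k a})"
      using wn unfolding words_def by blast
    moreover have "p \<noteq> 0 \<Longrightarrow> min p (k a) \<in> {1..k a}" using \<open>1 \<le> k a\<close> by auto
    ultimately show ?thesis using m(2) c unfolding subst_def by (auto split: if_splits)
  qed
  moreover have "v \<in> ran (lw w xs)"
  proof -
    obtain a where a: "w n a = Some v" using wn[OF n'] unfolding words_def ran_def by blast
    then have "lw w xs a = Some v" using list_word_apply[OF w xs(1) n, of a] by auto
    then show ?thesis by (rule ranI)
  qed
  ultimately show ?thesis unfolding words_def by blast
qed

text \<open>The terms of \<open>w\<close> have nonempty domains, arranged in the order of their
  indices; so comparing words amounts to comparing the indices in their codes.\<close>

lemma list_word_less_iff:
  assumes w: "w \<in> R" and xs: "index_list k xs" "has_var xs" and ys: "index_list k ys" "has_var ys"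
  shows "word_less (lw w xs) (lw w ys) \<longleftrightarrow> (\<forall>i\<in>fst ` set xs. \<forall>j\<in>fst ` set ys. i < j)"
proof -
  have *: "(\<forall>a\<in>dom (w i). \<forall>b\<in>dom (w j). a < b) \<longleftrightarrow> i < j"
    if "i \<in> fst ` set xs" "j \<in> fst ` set ys" for i j
  proof -
    have 1: "1 \<le> i" "1 \<le> j" using index_list_ge_1 xs ys that by blast+
    obtain a b where "a \<in> dom (w i)" "b \<in> dom (w j)"
      using 1 wordsD(2) seq_word[OF w] by (meson all_not_in_conv)
    then show ?thesis
      using seq_less[OF w] 1 by (metis less_asym less_irrefl linorder_neqE_nat)
  qed
  have "word_less (lw w xs) (lw w ys) \<longleftrightarrow>
      (\<forall>i\<in>fst ` set xs. \<forall>j\<in>fst ` set ys. \<forall>a\<in>dom (w i). \<forall>b\<in>dom (w j). a < b)"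
    unfolding word_less_iff[OF list_word_in_words[OF w xs] list_word_in_words[OF w ys]]
      dom_list_word ball_UN by meson
  also have "\<dots> \<longleftrightarrow> (\<forall>i\<in>fst ` set xs. \<forall>j\<in>fst ` set ys. i < j)"
    using * by (intro ball_cong refl) blast
  finally show ?thesis .
qed

section \<open>Words of words: composition and transitivity\<close>

lemma EV_in_words: "w \<in> R \<Longrightarrow> y \<in> E w \<Longrightarrow> y \<in> W"
  using list_word_in_words unfolding EV_eq by auto

lemma precD: "u \<lhd> w \<Longrightarrow> u \<in> R" "u \<lhd> w \<Longrightarrow> 1 \<le> n \<Longrightarrow> u n \<in> E w"
  by (auto simp: ev_prec_def)

text \<open>The lower bound on the indices of \<open>xs\<close> keeps substitutions admissible: \<open>p \<le> k n\<close> then gives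
  \<open>p \<le> k i\<close> for the indices \<open>i\<close> with respect to \<open>w\<close>.\<close>

lemma EV_comp:
  assumes w: "w \<in> R" and u: "u \<in> R" and ys: "index_list k ys" "has_var ys"
    and ex: "\<And>n. n \<in> fst ` set ys \<Longrightarrow>
      \<exists>xs. index_list k xs \<and> has_var xs \<and> u n = lw w xs \<and> (\<forall>i\<in>fst ` set xs. n \<le> i)"
  shows "lw u ys \<in> E w"
proof -
  obtain f where f: "\<And>n. n \<in> fst ` set ys \<Longrightarrow>
      index_list k (f n) \<and> has_var (f n) \<and> u n = lw w (f n) \<and> (\<forall>i\<in>fst ` set (f n). n \<le> i)"
    using ex by metis
  have "lw u ys = lw w (list_comp f ys)"
  proof (rule list_word_comp)
    show "dom (w i) \<subseteq> {1..}" if "n \<in> fst ` set ys" "i \<in> fst ` set (f n)" for n i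
      using f[OF that(1)] index_list_ge_1 that(2) wordsD(3) seq_word[OF w] by blast
  qed (use f in blast)
  moreover have "index_list k (list_comp f ys)"
    using ys(1) f
  proof (induction ys)
    case (Cons a ys)
    obtain n p where a: "a = (n, p)" by fastforce
    have n: "1 \<le> n" "p \<le> k n" and lt: "\<And>m. m \<in> fst ` set ys \<Longrightarrow> n < m" and ys: "index_list k ys"
      using Cons.prems(1) unfolding a index_list_def by auto
    have fn: "index_list k (f n)" "has_var (f n)" "u n = lw w (f n)" "\<And>i. i \<in> fst ` set (f n) \<Longrightarrow> n \<le> i"
      using Cons.prems(2)[of n] unfolding a by auto
    have "index_list k (list_subst p (f n))"
      using index_list_subst[OF fn(1)] n(2) k_le[OF n(1)] fn(4) le_trans by blast
    moreover have "index_list k (list_comp f ys)" using Cons ys by auto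
    \<comment> \<open>The order between indices of different blocks is recovered from the order of
      the words \<open>u n\<close> and \<open>u m\<close>.\<close>
    moreover have "i < j" if i: "i \<in> fst ` set (f n)" and j: "j \<in> fst ` set (list_comp f ys)" for i j
    proof -
      obtain m where m: "m \<in> fst ` set ys" "j \<in> fst ` set (f m)"
      proof -
        obtain m q where "(m, q) \<in> set ys" "j \<in> fst ` set (list_subst q (f m))"
          using j unfolding list_comp_def by (auto simp del: fst_set_list_subst)
        moreover from this have "m \<in> fst ` set ys" by force
        ultimately show thesis using that[of m] by simp
      qed
      have fm: "index_list k (f m)" "has_var (f m)" "u m = lw w (f m)"
        using Cons.prems(2)[of m] m(1) by auto
      have "word_less (u n) (u m)" using seq_word_less[OF u n(1) lt[OF m(1)]] .
      then show ?thesis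
        unfolding fn(3) fm(3) list_word_less_iff[OF w fn(1,2) fm(1,2)] using i m(2) by blast
    qed
    ultimately show ?case unfolding a list_comp_Cons index_list_append fst_set_list_subst by blast
  qed (simp add: index_list_def)
  moreover have "has_var (list_comp f ys)"
  proof -
    obtain n where n: "(n, 0) \<in> set ys" using ys(2) unfolding has_var_def by auto
    then obtain i where "(i, 0) \<in> set (f n)" using f unfolding has_var_def by fastforce
    then have "(i, 0) \<in> set (list_comp f ys)" unfolding list_comp_def using n by force
    then show ?thesis unfolding has_var_def by force
  qed
  ultimately show ?thesis unfolding EV_eq by blast
qed

text \<open>The codes of successive terms move strictly to the right, so their indices grow by at
  least one per step. This is the bound that \<open>EV_comp\<close> asks for.\<close>

lemma prec_index_le:
  assumes w: "w \<in> R" and u: "u \<lhd> w" and "1 \<le> n" "index_list k xs" "has_var xs" "u n = lw w xs"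
    "i \<in> fst ` set xs"
  shows "n \<le> i"
  using assms(3-)
proof (induction n arbitrary: xs i rule: dec_induct)
  case base
  then show ?case using index_list_ge_1 by blast
next
  case (step n)
  obtain zs where zs: "index_list k zs" "has_var zs" "u n = lw w zs"
    using precD(2)[OF u step(1)] unfolding EV_eq by blast
  obtain j where j: "j \<in> fst ` set zs" using has_var_not_Nil[OF zs(2)] by (cases zs) auto
  have "word_less (lw w zs) (lw w xs)"
    using seq_word_less[OF precD(1)[OF u] step(1), of "Suc n"] zs(3) step.prems(3) by simp
  then have "j < i"
    unfolding list_word_less_iff[OF w zs(1,2) step.prems(1,2)] using j step.prems(4) by blast
  moreover have "n \<le> j" using step.IH[OF zs j] .
  ultimately show ?case by simp
qed

lemma EV_prec:
  assumes w: "w \<in> R" and u: "u \<lhd> w" and y: "y \<in> E u" shows "y \<in> E w"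
proof -
  obtain ys where ys: "index_list k ys" "has_var ys" "y = lw u ys"
    using y unfolding EV_eq by blast
  have "lw u ys \<in> E w"
  proof (rule EV_comp[OF w precD(1)[OF u] ys(1,2)])
    fix n assume "n \<in> fst ` set ys"
    then have n: "1 \<le> n" using index_list_ge_1 ys by blast
    then obtain xs where xs: "index_list k xs" "has_var xs" "u n = lw w xs"
      using precD(2)[OF u] unfolding EV_eq by blast
    then show "\<exists>xs. index_list k xs \<and> has_var xs \<and> u n = lw w xs \<and> (\<forall>i\<in>fst ` set xs. n \<le> i)"
      using prec_index_le[OF w u n] by blast
  qed
  then show ?thesis using ys by simp
qed

lemma prec_trans: "w \<in> R \<Longrightarrow> x \<lhd> u \<Longrightarrow> u \<lhd> w \<Longrightarrow> x \<lhd> w"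
  using EV_prec unfolding ev_prec_def by blast

lemma seq_in_EV:
  assumes "1 \<le> n" shows "w n \<in> E w"
proof -
  have "index_list k [(n, 0)]" "has_var [(n, 0)]" using assms by auto
  then show ?thesis unfolding EV_eq using list_word_single[of alpha k v w n] by (metis (mono_tags, lifting) mem_Collect_eq)
qed

lemma prec_refl: "w \<in> R \<Longrightarrow> w \<lhd> w"
  using seq_in_EV unfolding ev_prec_def by blast

lemma tail_seq_in_R:
  assumes "w \<in> R" shows "tail_seq m w \<in> R"
  using seq_word[OF assms] seq_word_less[OF assms] by (intro seqI) (auto simp: tail_seq_def)

lemma tail_seq_prec: "w \<in> R \<Longrightarrow> tail_seq m w \<lhd> w"
  using tail_seq_in_R seq_in_EV unfolding ev_prec_def by (simp add: tail_seq_apply)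

text \<open>The last entry of \<open>t\<close> is \<open>x (length t)\<close>, so the first term
  past it is the next one.\<close>

lemma seq_minus_eq:
  assumes x: "x \<in> R" and t: "init_seg t x" shows "seq_minus x t = tail_seq (length t) x"
proof (cases "t = []")
  case True
  have "x = restrict x {1..}" using x unfolding word_seqs_def by (auto simp: PiE_restrict)
  then show ?thesis using True unfolding seq_minus_def tail_seq_def by simp
next
  case False
  then have last: "last t = x (length t)"
    using t unfolding init_seg_def by (simp add: last_conv_nth)
  have len: "1 \<le> length t" using False by (simp add: Suc_le_eq)
  have "(LEAST n. 1 \<le> n \<and> word_less (last t) (x n)) = Suc (length t)"
  proof (rule Least_equality)
    show "1 \<le> Suc (length t) \<and> word_less (last t) (x (Suc (length t)))"
      using seq_word_less[OF x len] last by simp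
    fix n assume n: "1 \<le> n \<and> word_less (last t) (x n)"
    show "Suc (length t) \<le> n"
    proof (rule ccontr)
      assume "\<not> Suc (length t) \<le> n"
      then have "n = length t \<or> n < length t" by auto
      moreover have "\<not> word_less (x (length t)) (x n)" if "n < length t"
        using seq_word_less[OF x _ that] n seq_word[OF x] len
          word_less_trans[of "x n" "x (length t)" "x n"] word_less_irrefl[of "x n"] by blast
      ultimately show False using n last word_less_irrefl seq_word[OF x] by auto
    qed
  qed
  then show ?thesis using False unfolding seq_minus_def tail_seq_def by simp
qed

lemma basic_iff:
  "x \<in> basic t u \<longleftrightarrow> x \<in> R \<and> init_seg t x \<and> (\<forall>n>length t. x n \<in> E u)"
proof -
  have "(\<forall>n\<ge>1. x (length t + n) \<in> E u) \<longleftrightarrow> (\<forall>n>length t. x n \<in> E u)"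
  proof (intro iffI allI impI)
    fix n assume "\<forall>n\<ge>1. x (length t + n) \<in> E u" "length t < n"
    then show "x n \<in> E u" by (auto dest: spec[of _ "n - length t"])
  qed auto
  then have "seq_minus x t \<lhd> u \<longleftrightarrow> (\<forall>n>length t. x n \<in> E u)" if "x \<in> R" "init_seg t x"
    unfolding seq_minus_eq[OF that] ev_prec_def using tail_seq_in_R[OF that(1)]
    by (simp add: tail_seq_apply)
  then show ?thesis unfolding basic_set_def by blast
qed

text \<open>Lists receive the colour of the word that they code over \<open>u\<close>; the resulting
  blocks, read as words over \<open>u\<close>, form \<open>x\<close>.\<close>

lemma EV_pigeonhole:
  assumes u: "u \<in> R"
  obtains x where "x \<lhd> u" "(\<forall>y\<in>E x. P y) \<or> (\<forall>y\<in>E x. \<not> P y)"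
proof -
  obtain f where f: "\<And>n. 1 \<le> n \<Longrightarrow> index_list k (f n)" "\<And>n. 1 \<le> n \<Longrightarrow> has_var (f n)"
    "\<And>n i j. 1 \<le> n \<Longrightarrow> i \<in> fst ` set (f n) \<Longrightarrow> j \<in> fst ` set (f (Suc n)) \<Longrightarrow> i < j"
    and mon: "(\<forall>ys. index_list k ys \<and> has_var ys \<longrightarrow> P (lw u (list_comp f ys))) \<or>
     (\<forall>ys. index_list k ys \<and> has_var ys \<longrightarrow> \<not> P (lw u (list_comp f ys)))"
    using variable_list_pigeonhole[OF k_mono, of "\<lambda>xs. P (lw u xs)"] by blast
  define x where "x = restrict (\<lambda>n. lw u (f n)) {1..}"
  have x: "x n = lw u (f n)" if "1 \<le> n" for n using that unfolding x_def by simp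
  have "x \<in> R"
  proof (rule seqI)
    show "x n \<in> W" if "1 \<le> n" for n using list_word_in_words[OF u f(1,2)] x that by simp
    show "word_less (x n) (x (Suc n))" if "1 \<le> n" for n
      using f that by (simp add: x list_word_less_iff[OF u])
  qed (simp add: x_def)
  then have "x \<lhd> u" unfolding ev_prec_def EV_eq using x f by blast
  moreover have "lw x ys = lw u (list_comp f ys)" if "index_list k ys" for ys
  proof (rule list_word_comp)
    show "x n = lw u (f n)" if "n \<in> fst ` set ys" for n
      using x index_list_ge_1 that \<open>index_list k ys\<close> by blast
    show "dom (u i) \<subseteq> {1..}" if "n \<in> fst ` set ys" "i \<in> fst ` set (f n)" for n i
      using index_list_ge_1 that \<open>index_list k ys\<close> f(1) wordsD(3) seq_word[OF u] by metis
  qed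
  then have "(\<forall>y\<in>E x. P y) \<or> (\<forall>y\<in>E x. \<not> P y)"
    using mon unfolding EV_eq by auto
  ultimately show thesis using that by blast
qed

subsection \<open>Fusion\<close>

lemma tuplesD: "t \<in> tuples \<Longrightarrow> y \<in> set t \<Longrightarrow> y \<in> W"
  by (auto simp: word_tuples_def)

lemma distinct_tuples: "t \<in> tuples \<Longrightarrow> distinct t"
proof (induction t)
  case (Cons y t)
  then show ?case using word_less_irrefl by (auto simp: word_tuples_def)
qed simp

lemma tuples_snoc: "t @ [y] \<in> tuples \<longleftrightarrow> t \<in> tuples \<and> y \<in> W \<and> after t y"
proof -
  have "word_less x y" if "t \<in> tuples" "y \<in> W" "after t y" "x \<in> set t" for x
  proof (cases "x = last t")
    case False
    have "t \<noteq> []" using that(4) by auto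
    then obtain s where s: "t = s @ [last t]" by (metis append_butlast_last_id)
    then have "x \<in> set s" using that(4) False by (metis Un_iff empty_iff insert_iff list.set set_append)
    then have "word_less x (last t)" using that(1) s
      by (metis (no_types, lifting) list.set_intros(1) mem_Collect_eq sorted_wrt_append word_tuples_def)
    moreover have "x \<in> W" "last t \<in> W" using tuplesD[OF that(1)] that(4) \<open>t \<noteq> []\<close> by auto
    ultimately show ?thesis
      using word_less_trans that(2,3) \<open>t \<noteq> []\<close> unfolding after_def by blast
  qed (use that in \<open>auto simp: after_def\<close>)
  moreover have "after t y" if "\<forall>x\<in>set t. word_less x y"
    using that unfolding after_def by (cases "t = []") auto
  ultimately show ?thesis by (auto simp: word_tuples_def sorted_wrt_append)
qed

lemma prefix_in_tuples: "x \<in> R \<Longrightarrow> prefix n x \<in> tuples"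
proof (induction n)
  case (Suc n)
  have "prefix (Suc n) x = prefix n x @ [x (Suc n)]" by (simp add: prefix_def)
  moreover have "after (prefix n x) (x (Suc n))"
    using seq_word_less[OF Suc.prems, of n "Suc n"] unfolding after_def prefix_def
    by (cases n) auto
  ultimately show ?case using Suc seq_word by (simp add: tuples_snoc)
qed (simp add: prefix_def word_tuples_def)

lemma after_init_seg:
  assumes "x \<in> R" "init_seg t x" "length t < n" shows "after t (x n)"
proof (cases "t = []")
  case False
  then have "last t = x (length t)"
    using assms(2) unfolding init_seg_def by (simp add: last_conv_nth)
  then show ?thesis using seq_word_less[OF assms(1) _ assms(3)] False
    unfolding after_def by (simp add: Suc_le_eq)
qed (simp add: after_def)

text \<open>The terms beyond \<open>t\<close> of a member of \<open>basic t y\<close> all come after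
  \<open>t\<close>, so the other words of \<open>E y\<close> are irrelevant. The hypothesis is the
  one in the heredity condition of \<open>fusion\<close>.\<close>

lemma basic_mono_after:
  assumes "\<And>z. z \<in> E y \<Longrightarrow> after t z \<Longrightarrow> z \<in> E x" shows "basic t y \<subseteq> basic t x"
  using assms after_init_seg unfolding basic_iff subset_iff by blast

lemma basic_mono: "x \<in> R \<Longrightarrow> y \<lhd> x \<Longrightarrow> basic t y \<subseteq> basic t x"
  using basic_mono_after EV_prec by blast

text \<open>By \<open>seq_index_le\<close>, shifting \<open>x\<close> by the largest position of
  \<open>last t\<close> is enough.\<close>

lemma exists_tail_after:
  assumes t: "t \<in> tuples" and x: "x \<in> R"
  obtains y where "y \<lhd> x" "\<And>n. 1 \<le> n \<Longrightarrow> after t (y n)"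
proof (cases "t = []")
  case True
  then show thesis using that[of x] prec_refl[OF x] by (simp add: after_def)
next
  case False
  then have l: "last t \<in> W" using tuplesD[OF t] by simp
  define m where "m = Max (dom (last t))"
  have "after t (tail_seq m x n)" if "1 \<le> n" for n
  proof -
    have "a < b" if a: "a \<in> dom (last t)" and b: "b \<in> dom (x (m + n))" for a b
    proof -
      have "a \<le> m" unfolding m_def using wordsD(1)[OF l] a by (rule Max_ge)
      also have "m < m + n" using \<open>1 \<le> n\<close> by simp
      also have "m + n \<le> b" using seq_index_le[OF x _ b] \<open>1 \<le> n\<close> by simp
      finally show ?thesis .
    qed
    then have "word_less (last t) (x (m + n))"
      using word_less_iff[OF l seq_word[OF x]] \<open>1 \<le> n\<close> by simp
    then show ?thesis unfolding after_def tail_seq_apply[OF that] by simp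
  qed
  then show thesis using that tail_seq_prec[OF x] by blast
qed

text \<open>The tuple need not be related to \<open>x\<close>; it is followed by a tail of
  \<open>x\<close> that starts past it. Nonemptiness yields the contradictions in the arguments
  about nowhere dense sets.\<close>

lemma basic_nonempty:
  assumes t: "t \<in> tuples" and x: "x \<in> R" shows "basic t x \<noteq> {}"
proof -
  obtain y where y: "y \<lhd> x" "\<And>n. 1 \<le> n \<Longrightarrow> after t (y n)"
    using exists_tail_after[OF t x] by blast
  have yR: "y \<in> R" using precD(1)[OF y(1)] .
  define l where "l = length t"
  define a where "a = restrict (\<lambda>i. if i \<le> l then t ! (i - 1) else y (i - l)) {1..}"
  have "a \<in> R"
  proof (rule seqI)
    fix n :: nat assume n: "1 \<le> n"
    show "a n \<in> W"
      using n tuplesD[OF t, of "t ! (n - 1)"] seq_word[OF yR, of "n - l"] unfolding a_def l_def by auto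
    consider "Suc n \<le> l" | "n = l" | "l < n" by linarith
    then show "word_less (a n) (a (Suc n))"
    proof cases
      case 1
      then have "word_less (t ! (n - 1)) (t ! n)"
        using t n unfolding word_tuples_def l_def by (auto simp: sorted_wrt_iff_nth_less)
      then show ?thesis using 1 n unfolding a_def by simp
    next
      case 2
      then have "t \<noteq> []" using n unfolding l_def by auto
      moreover from this have "last t = t ! (n - 1)" using 2 unfolding l_def by (simp add: last_conv_nth)
      ultimately have "t \<noteq> []" "last t = t ! (n - 1)" by blast+
      then show ?thesis using y(2)[of 1] 2 n unfolding a_def after_def by simp
    next
      case 3
      then have "word_less (y (n - l)) (y (Suc n - l))"
        using seq_word_less[OF yR, of "n - l" "Suc n - l"] by simp
      then show ?thesis using 3 n unfolding a_def by simp
    qed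
  qed (simp add: a_def)
  moreover have "init_seg t a" unfolding init_seg_def a_def l_def by simp
  moreover have "a n \<in> E x" if "length t < n" for n
    using precD(2)[OF y(1), of "n - l"] that unfolding a_def l_def by simp
  ultimately show ?thesis using basic_iff by blast
qed

text \<open>The sequence \<open>x\<close> is entered late enough to start past \<open>u j\<close>.
  That \<open>m\<close> is at least \<open>i\<close> is recorded because \<open>EV_comp\<close>
  needs codes whose indices do not drop.\<close>

lemma glue:
  assumes u: "u \<in> R" and x: "x \<lhd> u"
  obtains u' where "u' \<lhd> u" "\<And>i. 1 \<le> i \<Longrightarrow> i \<le> j \<Longrightarrow> u' i = u i" "\<And>i. j < i \<Longrightarrow> \<exists>m\<ge>i. u' i = x m"
proof -
  have xR: "x \<in> R" using precD(1)[OF x] .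
  define m where "m = (if j = 0 then 0 else Max (dom (u j)))"
  define u' where "u' = restrict (\<lambda>i. if i \<le> j then u i else x (i + m)) {1..}"
  have "u' \<in> R"
  proof (rule seqI)
    fix n :: nat assume n: "1 \<le> n"
    show "u' n \<in> W" using n seq_word[OF u] seq_word[OF xR] unfolding u'_def by simp
    consider "Suc n \<le> j" | "n = j" | "j < n" by linarith
    then show "word_less (u' n) (u' (Suc n))"
    proof cases
      case 2
      have "a < b" if a: "a \<in> dom (u j)" and b: "b \<in> dom (x (Suc j + m))" for a b
      proof -
        have "a \<le> m" unfolding m_def using 2 n a wordsD(1)[OF seq_word[OF u]] by simp
        also have "m < Suc j + m" by simp
        also have "\<dots> \<le> b" using seq_index_le[OF xR _ b] by simp
        finally show ?thesis .
      qed
      then have "word_less (u j) (x (Suc j + m))"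
        using word_less_iff[OF seq_word[OF u] seq_word[OF xR]] 2 n by simp
      then show ?thesis using 2 n unfolding u'_def by simp
    qed (use n seq_word_less[OF u, of n "Suc n"] seq_word_less[OF xR, of "n + m" "Suc n + m"] in
        \<open>simp_all add: u'_def\<close>)
  qed (simp add: u'_def)
  moreover have "u' n \<in> E u" if "1 \<le> n" for n
    using seq_in_EV[OF that] precD(2)[OF x, of "n + m"] that unfolding u'_def by simp
  ultimately have "u' \<lhd> u" unfolding ev_prec_def by blast
  moreover have "\<exists>m\<ge>i. u' i = x m" if "j < i" for i
    using that unfolding u'_def by (intro exI[of _ "i + m"]) simp
  ultimately show thesis using that[of u'] unfolding u'_def by simp
qed

text \<open>Words of \<open>EV u\<close> after such a tuple only use terms of \<open>u\<close> beyond the \<open>j\<close>-th, so they are not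
  affected by the first \<open>j\<close> terms, which the fusion has already fixed.\<close>

definition ends_at :: "nat \<Rightarrow> (nat \<Rightarrow> 'a word) \<Rightarrow> 'a word list \<Rightarrow> bool" where
  "ends_at j u t \<longleftrightarrow> j = 0 \<or> t \<noteq> [] \<and> last t \<in> W \<and> dom (u j) \<subseteq> dom (last t)"

text \<open>The code of \<open>y\<close> over \<open>u'\<close> involves only indices n beyond
  \<open>j\<close>, where \<open>u' n\<close> is some \<open>x m\<close> with m \<ge> n and has the
  one-entry code \<open>[(m, 0)]\<close> over \<open>x\<close>; so \<open>EV_comp\<close>
  applies.\<close>

lemma glue_EV:
  assumes u: "u \<in> R" and x: "x \<in> R" and u': "u' \<in> R"
    and eq: "\<And>i. 1 \<le> i \<Longrightarrow> i \<le> j \<Longrightarrow> u' i = u i" and late: "\<And>i. j < i \<Longrightarrow> \<exists>m\<ge>i. u' i = x m"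
    and t: "ends_at j u t" and y: "y \<in> E u'" "after t y"
  shows "y \<in> E x"
proof -
  obtain ys where ys: "index_list k ys" "has_var ys" "y = lw u' ys"
    using y(1) unfolding EV_eq by blast
  have yW: "y \<in> W" using EV_in_words[OF u' y(1)] .
  have "j < n" if n: "n \<in> fst ` set ys" for n
  proof (rule ccontr)
    assume "\<not> j < n"
    then have nj: "n \<le> j" by simp
    have n1: "1 \<le> n" using index_list_ge_1[OF ys(1) n] .
    then have t': "t \<noteq> []" "last t \<in> W" "dom (u j) \<subseteq> dom (last t)"
      using t nj unfolding ends_at_def by auto
    then have less: "a < b" if "a \<in> dom (u j)" "b \<in> dom y" for a b
      using y(2) that word_less_iff[OF t'(2) yW] unfolding after_def by blast
    obtain b where b: "b \<in> dom (u n)" using wordsD(2)[OF seq_word[OF u n1]] by blast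
    then have by': "b \<in> dom y" 
      unfolding ys(3) dom_list_word using n eq[OF n1 nj] by (intro UN_I[of n]) simp_all
    show False
    proof (cases "n = j")
      case True
      then show False using less[OF _ by'] b by blast
    next
      case False
      obtain a where a: "a \<in> dom (u j)" using wordsD(2)[OF seq_word[OF u, of j]] n1 nj by fastforce
      have "b < a" using seq_less[OF u n1 _ b a] False nj by simp
      then show False using less[OF a by'] by simp
    qed
  qed
  moreover have "index_list k [(m, 0)] \<and> has_var [(m, 0)] \<and> x m = lw x [(m, 0)] \<and>
      (\<forall>i\<in>fst ` set [(m, 0::nat)]. n \<le> i)" if "j < n" "n \<le> m" for m n
    using that by (simp add: list_word_single)
  ultimately have "\<exists>xs. index_list k xs \<and> has_var xs \<and> u' n = lw x xs \<and> (\<forall>i\<in>fst ` set xs. n \<le> i)"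
    if "n \<in> fst ` set ys" for n
    using late that by metis
  then show ?thesis unfolding ys(3) by (rule EV_comp[OF x u' ys(1,2)])
qed

text \<open>The tuples of \<open>D\<close> are treated one at a time: refine for \<open>t\<close>,
  then \<open>glue\<close> to restore the first \<open>j\<close> terms. By \<open>glue_EV\<close>
  the words after \<open>t\<close> stay in \<open>E y\<close>, so \<open>hered\<close> transfers
  \<open>Q t\<close>; requirements met earlier pass to every refinement.\<close>

lemma fusion_step:
  assumes hered: "\<And>t x y. x \<in> R \<Longrightarrow> y \<in> R \<Longrightarrow> Q t x \<Longrightarrow>
      (\<And>z. z \<in> E y \<Longrightarrow> after t z \<Longrightarrow> z \<in> E x) \<Longrightarrow> Q t y"
    and "finite D" and u: "u \<in> R"
    and "\<And>t x. t \<in> D \<Longrightarrow> x \<lhd> u \<Longrightarrow> \<exists>y. y \<lhd> x \<and> Q t y"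
    and "\<And>t. t \<in> D \<Longrightarrow> ends_at j u t"
  shows "\<exists>u'. u' \<lhd> u \<and> (\<forall>i. 1 \<le> i \<and> i \<le> j \<longrightarrow> u' i = u i) \<and> (\<forall>t\<in>D. Q t u')"
  using assms(2,4,5)
proof (induction D rule: finite_induct)
  case empty
  then show ?case using prec_refl[OF u] by blast
next
  case (insert t D)
  then obtain u1 where u1: "u1 \<lhd> u" "\<And>i. 1 \<le> i \<Longrightarrow> i \<le> j \<Longrightarrow> u1 i = u i" "\<And>t. t \<in> D \<Longrightarrow> Q t u1"
    by (metis insertCI)
  then obtain y where y: "y \<lhd> u1" "Q t y" using insert.prems(1) by blast
  have R1: "u1 \<in> R" "y \<in> R" using precD(1) u1(1) y(1) by auto
  obtain u2 where u2: "u2 \<lhd> u1" "\<And>i. 1 \<le> i \<Longrightarrow> i \<le> j \<Longrightarrow> u2 i = u1 i" "\<And>i. j < i \<Longrightarrow> \<exists>m\<ge>i. u2 i = y m"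
    using glue[OF R1(1) y(1)] by metis
  have R2: "u2 \<in> R" using precD(1) u2(1) by auto
  have "ends_at j u1 t" using insert.prems(2)[of t] u1(2)[of j] unfolding ends_at_def by (cases j) auto
  then have "Q t u2" using hered[OF R1(2) R2 y(2)] glue_EV[OF R1 R2 u2(2,3)] by blast
  moreover have "Q t' u2" if "t' \<in> D" for t'
    using hered[OF R1(1) R2 u1(3)[OF that]] EV_prec[OF R1(1) u2(1)] by blast
  moreover have "u2 \<lhd> u" using prec_trans[OF u u2(1) u1(1)] .
  ultimately show ?case using u1(2) u2(2) by auto
qed

definition EV_upto :: "nat \<Rightarrow> (nat \<Rightarrow> 'a word) \<Rightarrow> 'a word set" where
  "EV_upto j u = {lw u xs | xs. index_list k xs \<and> has_var xs \<and> fst ` set xs \<subseteq> {1..j}}"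

text \<open>By monotonicity of \<open>k\<close>, the codes are duplicate-free lists over one finite
  set of pairs.\<close>

lemma finite_EV_upto: "finite (EV_upto j u)"
proof -
  have "set xs \<subseteq> {1..j} \<times> {..k j} \<and> distinct xs" if "index_list k xs" "fst ` set xs \<subseteq> {1..j}" for xs
  proof
    show "set xs \<subseteq> {1..j} \<times> {..k j}"
    proof
      fix a assume a: "a \<in> set xs"
      obtain n p where np: "a = (n, p)" by fastforce
      then have "n \<in> {1..j}" using that(2) a by force
      moreover have "p \<le> k n" using that(1) a np unfolding index_list_def by auto
      ultimately show "a \<in> {1..j} \<times> {..k j}" using k_le[of n j] np by auto
    qed
    have "distinct (map fst xs)"
      using that(1) unfolding index_list_def strict_sorted_iff by blast
    then show "distinct xs" by (simp add: distinct_map)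
  qed
  then have "EV_upto j u \<subseteq> lw u ` {xs. set xs \<subseteq> {1..j} \<times> {..k j} \<and> distinct xs}"
    unfolding EV_upto_def by blast
  moreover have "finite {xs. set xs \<subseteq> {1..j} \<times> {..k j} \<and> distinct xs}"
    by (rule finite_subset_distinct) simp
  ultimately show ?thesis by (meson finite_imageI finite_subset)
qed

lemma EV_upto_subset: "EV_upto j u \<subseteq> E u"
  unfolding EV_upto_def EV_eq by blast

lemma EV_upto_cong:
  assumes "\<And>i. 1 \<le> i \<Longrightarrow> i \<le> j \<Longrightarrow> u i = u' i" shows "EV_upto j u = EV_upto j u'"
proof -
  have "lw u xs = lw u' xs" if "fst ` set xs \<subseteq> {1..j}" for xs
    by (rule list_word_cong) (use that assms in auto)
  then show ?thesis unfolding EV_upto_def by (metis (no_types, lifting))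
qed

text \<open>Diagonalisation: stage \<open>j\<close> meets the finitely many requirements that first
  involve the \<open>j\<close>-th term, without changing the first \<open>j\<close> terms. Gluing
  preserves these terms at the price of words that do not come after \<open>t\<close>, and
  \<open>hered\<close> has to tolerate such words.\<close>

theorem fusion:
  assumes w: "w \<in> R" and t0: "t0 \<in> tuples"
    and hered: "\<And>t x y. x \<in> R \<Longrightarrow> y \<in> R \<Longrightarrow> Q t x \<Longrightarrow>
      (\<And>z. z \<in> E y \<Longrightarrow> after t z \<Longrightarrow> z \<in> E x) \<Longrightarrow> Q t y"
    and dens: "\<And>s x. t0 @ s \<in> tuples \<Longrightarrow> set s \<subseteq> E w \<Longrightarrow> x \<lhd> w \<Longrightarrow> \<exists>y. y \<lhd> x \<and> Q (t0 @ s) y"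
  obtains u where "u \<lhd> w" "\<And>s. t0 @ s \<in> tuples \<Longrightarrow> set s \<subseteq> E u \<Longrightarrow> Q (t0 @ s) u"
proof -
  \<comment> \<open>\<open>S j u\<close> gathers the extensions whose last word involves the term
    \<open>u j\<close> and none of whose words uses a later one. Stage 0 handles \<open>t0\<close>
    alone.\<close>
  define S where "S j u = {s. t0 @ s \<in> tuples \<and> (if j = 0 then s = [] else
    s \<noteq> [] \<and> dom (u j) \<subseteq> dom (last s) \<and> set s \<subseteq> EV_upto j u)}" for j u
  have S_cong: "S j u = S j u'" if "\<And>i. 1 \<le> i \<Longrightarrow> i \<le> j \<Longrightarrow> u i = u' i" for j u u'
    using that[of j] EV_upto_cong[OF that] unfolding S_def by (cases j) auto
  have finS: "finite (S j u)" for j u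
  proof (rule finite_subset)
    show "S j u \<subseteq> {s. set s \<subseteq> EV_upto j u \<and> distinct s}"
    proof
      fix s assume s: "s \<in> S j u"
      then have "distinct (t0 @ s)" unfolding S_def using distinct_tuples by blast
      then show "s \<in> {s. set s \<subseteq> EV_upto j u \<and> distinct s}"
        using s unfolding S_def by (auto split: if_splits)
    qed
    show "finite {s. set s \<subseteq> EV_upto j u \<and> distinct s}"
      using finite_EV_upto by (rule finite_subset_distinct)
  qed
  have step: "\<exists>u'. u' \<lhd> u \<and> (\<forall>i. 1 \<le> i \<and> i \<le> j \<longrightarrow> u' i = u i) \<and> (\<forall>s\<in>S j u. Q (t0 @ s) u')"
    if u: "u \<lhd> w" for j u
  proof -
    have uR: "u \<in> R" using precD(1)[OF u] .
    have "\<exists>u'. u' \<lhd> u \<and> (\<forall>i. 1 \<le> i \<and> i \<le> j \<longrightarrow> u' i = u i) \<and> (\<forall>t\<in>(@) t0 ` S j u. Q t u')"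
    proof (rule fusion_step[OF _ _ uR])
      show "Q t y" if "x \<in> R" "y \<in> R" "Q t x" "\<And>z. z \<in> E y \<Longrightarrow> after t z \<Longrightarrow> z \<in> E x" for t x y
        using hered[OF that] .
    next
      show "finite ((@) t0 ` S j u)" using finS by simp
    next
      fix t x assume t: "t \<in> (@) t0 ` S j u" and x: "x \<lhd> u"
      then obtain s where s: "t = t0 @ s" "s \<in> S j u" by blast
      have "set s \<subseteq> E u" using s(2) EV_upto_subset[of j u] unfolding S_def by (cases "j = 0") auto
      then have "set s \<subseteq> E w" using EV_prec[OF w u] by blast
      then show "\<exists>y. y \<lhd> x \<and> Q t y"
        using dens[of s x] prec_trans[OF w x u] s unfolding S_def by blast
    next
      fix t assume "t \<in> (@) t0 ` S j u"
      then obtain s where s: "t = t0 @ s" "s \<in> S j u" by blast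
      show "ends_at j u t"
      proof (cases "j = 0")
        case False
        then have *: "s \<noteq> []" "dom (u j) \<subseteq> dom (last s)" "t0 @ s \<in> tuples"
          using s(2) unfolding S_def by auto
        then have "last s \<in> W" using tuplesD[OF *(3), of "last s"] by simp
        then show ?thesis using * s(1) unfolding ends_at_def by simp
      qed (simp add: ends_at_def)
    qed
    then show ?thesis by blast
  qed
  define P where "P j u \<longleftrightarrow> u \<lhd> w \<and> (\<forall>s\<in>S j u. Q (t0 @ s) u)" for j u
  \<comment> \<open>The step to stage \<open>Suc j\<close> keeps the first \<open>Suc j\<close>
    terms, so \<open>S (Suc j)\<close> is the same set before and after it.\<close>
  have "\<exists>U. \<forall>j. P j (U j) \<and> (U (Suc j) \<lhd> U j \<and> (\<forall>i. 1 \<le> i \<and> i \<le> Suc j \<longrightarrow> U (Suc j) i = U j i))"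
  proof (rule dependent_nat_choice)
    obtain u where u: "u \<lhd> w" "\<forall>s\<in>S 0 w. Q (t0 @ s) u"
      using step[OF prec_refl[OF w], of 0] by blast
    moreover have "S 0 w = S 0 u" by (rule S_cong) simp
    ultimately show "\<exists>u. P 0 u" unfolding P_def by auto
  next
    fix u j assume "P j u"
    then have u: "u \<lhd> w" unfolding P_def by simp
    obtain u' where u': "u' \<lhd> u" "\<forall>i. 1 \<le> i \<and> i \<le> Suc j \<longrightarrow> u' i = u i" "\<forall>s\<in>S (Suc j) u. Q (t0 @ s) u'"
      using step[OF u, of "Suc j"] by blast
    moreover have "S (Suc j) u = S (Suc j) u'" by (rule S_cong) (use u'(2) in simp)
    moreover have "u' \<lhd> w" using prec_trans[OF w u'(1) u] .
    ultimately show "\<exists>u'. P (Suc j) u' \<and> (u' \<lhd> u \<and> (\<forall>i. 1 \<le> i \<and> i \<le> Suc j \<longrightarrow> u' i = u i))"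
      unfolding P_def by auto
  qed
  then obtain U where PU: "\<And>j. P j (U j)" and U_Suc: "\<And>j. U (Suc j) \<lhd> U j"
    and U_eq: "\<And>i j. 1 \<le> i \<Longrightarrow> i \<le> Suc j \<Longrightarrow> U (Suc j) i = U j i" by blast
  have Uw: "U j \<lhd> w" and UR: "U j \<in> R" for j using PU[of j] precD(1) unfolding P_def by auto
  have U_mono: "U n \<lhd> U j" if "j \<le> n" for j n
    using that by (induction n rule: dec_induct) (use prec_refl UR prec_trans U_Suc in blast)+
  have agree: "U j i = U i i" if "1 \<le> i" "i \<le> j" for i j
    using that(2) by (induction j rule: dec_induct) (use U_eq that(1) in auto)
  \<comment> \<open>From stage \<open>i\<close> on the \<open>i\<close>-th term no longer changes,
    so the diagonal agrees with \<open>U j\<close> up to index \<open>j\<close>.\<close>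
  define u where "u = restrict (\<lambda>i. U i i) {1..}"
  have u_eq: "u i = U j i" if "1 \<le> i" "i \<le> j" for i j using agree[OF that] that unfolding u_def by simp
  have uR: "u \<in> R"
  proof (rule seqI)
    fix n :: nat assume n: "1 \<le> n"
    show "u n \<in> W" using seq_word[OF UR n] u_eq[OF n order_refl] by simp
    show "word_less (u n) (u (Suc n))"
      using seq_word_less[OF UR n, of "Suc n" "Suc n"] u_eq[OF n, of "Suc n"] u_eq[of "Suc n" "Suc n"]
      by simp
  qed (simp add: u_def)
  have uU: "u \<lhd> U j" for j
    unfolding ev_prec_def
  proof (intro conjI allI impI uR)
    fix n :: nat assume n: "1 \<le> n"
    show "u n \<in> E (U j)"
    proof (cases "n \<le> j")
      case True
      then show ?thesis using u_eq[OF n True] seq_in_EV[OF n] by simp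
    next
      case False
      then show ?thesis using u_eq[OF n order_refl] precD(2)[OF U_mono n, of j n] by simp
    qed
  qed
  have "Q (t0 @ s) u" if ts: "t0 @ s \<in> tuples" and s: "set s \<subseteq> E u" for s
  proof -
    have "\<exists>j. s \<in> S j (U j)"
    proof (cases "s = []")
      case True
      then show ?thesis using ts unfolding S_def by (intro exI[of _ 0]) simp
    next
      case False
      then have "last s \<in> E u" using s by auto
      then obtain xs where xs: "index_list k xs" "has_var xs" "last s = lw u xs"
        unfolding EV_eq by blast
      \<comment> \<open>The stage of \<open>s\<close> is the largest index used by its last word;
        the earlier words of \<open>s\<close> lie to the left and use smaller indices.\<close>
      define j where "j = Max (fst ` set xs)"
      have ne: "fst ` set xs \<noteq> {}" using has_var_not_Nil[OF xs(2)] by simp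
      then have jin: "j \<in> fst ` set xs" unfolding j_def by (intro Max_in) auto
      have j1: "1 \<le> j" using index_list_ge_1[OF xs(1) jin] .
      have "y \<in> EV_upto j (U j)" if y: "y \<in> set s" for y
      proof -
        have "\<exists>ys. index_list k ys \<and> has_var ys \<and> y = lw u ys \<and> (\<forall>i\<in>fst ` set ys. i \<le> j)"
        proof (cases "y = last s")
          case True
          moreover have "\<forall>i\<in>fst ` set xs. i \<le> j" unfolding j_def by simp
          ultimately show ?thesis using xs by blast
        next
          case False
          have "y \<in> E u" using s y by blast
          then obtain ys where ys: "index_list k ys" "has_var ys" "y = lw u ys"
            unfolding EV_eq by blast
          obtain r where "s = r @ [last s]" using \<open>s \<noteq> []\<close> by (metis append_butlast_last_id)
          moreover from this have "y \<in> set r" using y False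
            by (metis Un_iff empty_iff insert_iff list.set set_append)
          moreover have "sorted_wrt word_less s" using ts by (auto simp: word_tuples_def sorted_wrt_append)
          ultimately have "word_less y (last s)" by (metis list.set_intros(1) sorted_wrt_append)
          then have "\<forall>i\<in>fst ` set ys. i < j"
            unfolding ys(3) xs(3) list_word_less_iff[OF uR ys(1,2) xs(1,2)] using jin by blast
          then have "\<forall>i\<in>fst ` set ys. i \<le> j" using less_imp_le by blast
          then show ?thesis using ys by blast
        qed
        then obtain ys where ys: "index_list k ys" "has_var ys" "y = lw u ys" "\<forall>i\<in>fst ` set ys. i \<le> j"
          by blast
        have sub: "fst ` set ys \<subseteq> {1..j}"
          using index_list_ge_1[OF ys(1)] ys(4) by (meson atLeastAtMost_iff subsetI)
        have "y = lw (U j) ys"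
          unfolding ys(3) by (rule list_word_cong) (use sub u_eq in auto)
        then show ?thesis unfolding EV_upto_def using ys(1,2) sub by blast
      qed
      moreover have "dom (U j j) \<subseteq> dom (last s)"
        unfolding xs(3) dom_list_word using jin u_eq[OF j1 order_refl] by auto
      ultimately show ?thesis using ts False j1 unfolding S_def by (intro exI[of _ j]) auto
    qed
    then obtain j where j: "s \<in> S j (U j)" ..
    then have "Q (t0 @ s) (U j)" using PU[of j] unfolding P_def by blast
    then show ?thesis using hered[OF UR uR] EV_prec[OF UR uU] by blast
  qed
  moreover have "u \<lhd> w" using prec_trans[OF w uU Uw] .
  ultimately show thesis using that by blast
qed

subsection \<open>The Ellentuck topology\<close>

abbreviation "ET \<equiv> ellentuck_topology alpha k v"

lemma openin_basic: "t \<in> tuples \<Longrightarrow> s \<in> R \<Longrightarrow> openin ET (basic t s)"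
  unfolding ellentuck_topology_def by (rule topology_generated_by_Basis) blast

lemma topspace_ET: "topspace ET = R"
proof -
  have "[] \<in> tuples" by (simp add: word_tuples_def)
  moreover have "x \<in> basic [] x" if "x \<in> R" for x
    using that seq_in_EV unfolding basic_iff by (simp add: init_seg_def)
  moreover have "basic t s \<subseteq> R" for t s unfolding basic_iff subset_iff by blast
  ultimately show ?thesis
    unfolding ellentuck_topology_def topology_generated_by_topspace by blast
qed

text \<open>The eventual form in \<open>n\<close> makes finite intersections immediate and later
  lets \<open>n\<close> exceed the length of a given stem.\<close>

lemma openin_basic_subset:
  assumes "openin ET G" "x \<in> G"
  shows "\<exists>m. \<forall>n\<ge>m. basic (prefix n x) (tail_seq n x) \<subseteq> G"
proof -
  have "generate_topology_on
      {basic t s | t s. t \<in> tuples \<and> s \<in> R} G"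
    using assms(1) unfolding ellentuck_topology_def openin_topology_generated_by_iff .
  then show ?thesis using assms(2)
  proof (induction rule: generate_topology_on.induct)
    case (Int a b)
    then obtain m m' where "\<forall>n\<ge>m. basic (prefix n x) (tail_seq n x) \<subseteq> a"
      "\<forall>n\<ge>m'. basic (prefix n x) (tail_seq n x) \<subseteq> b" by blast
    then show ?case by (intro exI[of _ "max m m'"]) simp
  next
    case (UN K)
    then obtain G where G: "G \<in> K" "x \<in> G" by blast
    then obtain m where "\<forall>n\<ge>m. basic (prefix n x) (tail_seq n x) \<subseteq> G" using UN.IH by blast
    then show ?case using G(1) by (intro exI[of _ m]) blast
  next
    case (Basis B)
    then obtain t s where B: "B = basic t s" "t \<in> tuples" "s \<in> R" by blast
    then have x: "x \<in> R" "t = prefix (length t) x" "\<And>n. length t < n \<Longrightarrow> x n \<in> E s"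
      using Basis.prems unfolding B basic_iff init_seg_iff_prefix by auto
    have "basic (prefix n x) (tail_seq n x) \<subseteq> basic t s" if n: "length t \<le> n" for n
    proof
      fix a assume "a \<in> basic (prefix n x) (tail_seq n x)"
      then have a: "a \<in> R" "prefix n x = prefix n a" "\<And>i. n < i \<Longrightarrow> a i \<in> E (tail_seq n x)"
        unfolding basic_iff init_seg_iff_prefix by auto
      have eq: "x i = a i" if "1 \<le> i" "i \<le> n" for i
      proof -
        have "prefix n x ! (i - 1) = prefix n a ! (i - 1)" using a(2) by simp
        then show ?thesis using that unfolding prefix_def by (simp del: upt_Suc)
      qed
      have "tail_seq n x \<lhd> s"
        using tail_seq_in_R[OF x(1)] x(3) n unfolding ev_prec_def by (simp add: tail_seq_apply)
      then have late: "a i \<in> E s" if "n < i" for i using EV_prec[OF B(3)] a(3)[OF that] by blast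
      have "a i \<in> E s" if "length t < i" for i
        using late eq[of i] x(3)[OF that] that by (cases "i \<le> n") auto
      moreover have "init_seg t a"
        unfolding init_seg_iff_prefix
        by (subst x(2)) (use eq n in \<open>auto simp: prefix_def simp del: upt_Suc\<close>)
      ultimately show "a \<in> basic t s" using a(1) unfolding basic_iff by blast
    qed
    then show ?case unfolding B by blast
  qed simp
qed

lemma mem_basic_prefix:
  assumes "x \<in> R" "\<And>i. n < i \<Longrightarrow> x i \<in> E y" shows "x \<in> basic (prefix n x) y"
  using assms init_seg_prefix unfolding basic_iff by simp

lemma nonempty_open_basic:
  assumes "openin ET G" "G \<noteq> {}"
  obtains t s where "t \<in> tuples" "s \<in> R" "basic t s \<subseteq> G"
proof -
  obtain x where x: "x \<in> G" using assms(2) by blast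
  then have xR: "x \<in> R" using openin_subset[OF assms(1)] topspace_ET by blast
  obtain m where "basic (prefix m x) (tail_seq m x) \<subseteq> G" using openin_basic_subset[OF assms(1) x] by blast
  then show thesis using that prefix_in_tuples[OF xR] tail_seq_in_R[OF xR] by blast
qed

text \<open>This brings long initial segments into the form \<open>t @ s\<close> about which
  \<open>fusion\<close> gives information.\<close>

lemma basic_prefixE:
  assumes x: "x \<in> basic t u" and n: "length t \<le> n"
  obtains s where "prefix n x = t @ s" "t @ s \<in> tuples" "set s \<subseteq> E u" "x \<in> basic (t @ s) u"
proof -
  have x': "x \<in> R" "t = prefix (length t) x" "\<And>n. length t < n \<Longrightarrow> x n \<in> E u"
    using x unfolding basic_iff init_seg_iff_prefix by auto
  define s where "s = map x [Suc (length t)..<Suc n]"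
  have eq: "prefix n x = t @ s" using prefix_append[OF n, of x] x'(2) unfolding s_def by simp
  moreover have "set s \<subseteq> E u" using x'(3) unfolding s_def by auto
  moreover have "x \<in> basic (prefix n x) u" using mem_basic_prefix[OF x'(1)] x'(3) n by simp
  ultimately show thesis using that[of s] prefix_in_tuples[OF x'(1), of n] by simp
qed

section \<open>Combinatorial forcing for open families\<close>

context
  fixes U :: "(nat \<Rightarrow> 'a word) set"
begin

definition accepts :: "'a word list \<Rightarrow> (nat \<Rightarrow> 'a word) \<Rightarrow> bool" where
  "accepts t x \<longleftrightarrow> basic t x \<subseteq> U"

text \<open>Rejection is inherited by refinements, which mere failure to accept is not.\<close>

definition rejects :: "'a word list \<Rightarrow> (nat \<Rightarrow> 'a word) \<Rightarrow> bool" where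
  "rejects t x \<longleftrightarrow> (\<forall>y. y \<lhd> x \<longrightarrow> \<not> accepts t y)"

lemma accepts_prec: "x \<in> R \<Longrightarrow> y \<lhd> x \<Longrightarrow> accepts t x \<Longrightarrow> accepts t y"
  using basic_mono unfolding accepts_def by blast

text \<open>If some z \<lhd> y accepted \<open>t\<close>, a tail of z past \<open>t\<close> would
  have all its terms in \<open>E x\<close>, and so be a refinement of \<open>x\<close> that accepts
  \<open>t\<close>.\<close>

lemma decided_after:
  assumes t: "t \<in> tuples" and x: "x \<in> R" and y: "y \<in> R"
    and after: "\<And>z. z \<in> E y \<Longrightarrow> after t z \<Longrightarrow> z \<in> E x"
    and dec: "accepts t x \<or> rejects t x"
  shows "accepts t y \<or> rejects t y"
proof -
  have "rejects t y" if rej: "rejects t x"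
    unfolding rejects_def
  proof (intro allI impI notI)
    fix z assume z: "z \<lhd> y" "accepts t z"
    have zR: "z \<in> R" using precD(1)[OF z(1)] .
    obtain z' where z': "z' \<lhd> z" "\<And>n. 1 \<le> n \<Longrightarrow> after t (z' n)"
      using exists_tail_after[OF t zR] by blast
    have "z' n \<in> E x" if "1 \<le> n" for n
      using after z'(2)[OF that] precD(2)[OF prec_trans[OF y z'(1) z(1)] that] by blast
    then have "z' \<lhd> x" using precD(1)[OF z'(1)] unfolding ev_prec_def by blast
    moreover have "accepts t z'" using accepts_prec[OF zR z'(1) z(2)] .
    ultimately show False using rej unfolding rejects_def by blast
  qed
  moreover have "accepts t y" if "accepts t x"
    using basic_mono_after[of y t x] after that unfolding accepts_def by blast
  ultimately show ?thesis using dec by blast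
qed

text \<open>Density is immediate: either some y \<lhd> x accepts, or \<open>x\<close> rejects. The
  guard \<open>t \<in> tuples\<close> belongs to the fused property because
  \<open>decided_after\<close> requires it.\<close>

lemma exists_deciding:
  assumes t0: "t0 \<in> tuples" and w: "w \<in> R"
  obtains u where "u \<lhd> w"
    "\<And>s. t0 @ s \<in> tuples \<Longrightarrow> set s \<subseteq> E u \<Longrightarrow> accepts (t0 @ s) u \<or> rejects (t0 @ s) u"
proof (rule fusion[OF w t0, of "\<lambda>t x. t \<in> tuples \<longrightarrow> accepts t x \<or> rejects t x"])
  fix t x y
  assume "x \<in> R" "y \<in> R" "t \<in> tuples \<longrightarrow> accepts t x \<or> rejects t x"
    "\<And>z. z \<in> E y \<Longrightarrow> after t z \<Longrightarrow> z \<in> E x"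
  then show "t \<in> tuples \<longrightarrow> accepts t y \<or> rejects t y"
    using decided_after[of t x y] by blast
next
  fix s x assume x: "x \<lhd> w"
  have xR: "x \<in> R" using precD(1)[OF x] .
  show "\<exists>y. y \<lhd> x \<and> (t0 @ s \<in> tuples \<longrightarrow> accepts (t0 @ s) y \<or> rejects (t0 @ s) y)"
    using prec_refl[OF xR] unfolding rejects_def by blast
next
  fix u assume "u \<lhd> w"
    "\<And>s. t0 @ s \<in> tuples \<Longrightarrow> set s \<subseteq> E u \<Longrightarrow>
      t0 @ s \<in> tuples \<longrightarrow> accepts (t0 @ s) u \<or> rejects (t0 @ s) u"
  then show thesis using that by blast
qed

text \<open>The pigeonhole principle enters here, colouring y by whether \<open>u\<close> accepts
  \<open>t @ [y]\<close>. If all of \<open>E z\<close> were accepted, z would accept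
  \<open>t\<close>, since a member of \<open>basic t z\<close> lies in
  \<open>basic (t @ [y]) u\<close> for its next term y.\<close>

lemma rejects_extension:
  assumes u: "u \<in> R" and x: "x \<lhd> u" and t: "t \<in> tuples" and rej: "rejects t u"
    and dec: "\<And>y. y \<in> E u \<Longrightarrow> after t y \<Longrightarrow> accepts (t @ [y]) u \<or> rejects (t @ [y]) u"
  shows "\<exists>z. z \<lhd> x \<and> (\<forall>y\<in>E z. after t y \<longrightarrow> rejects (t @ [y]) u)"
proof -
  have xR: "x \<in> R" using precD(1)[OF x] .
  obtain z where z: "z \<lhd> x" and mon: "(\<forall>y\<in>E z. accepts (t @ [y]) u) \<or> (\<forall>y\<in>E z. \<not> accepts (t @ [y]) u)"
    using EV_pigeonhole[OF xR, of "\<lambda>y. accepts (t @ [y]) u"] by blast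
  have zu: "z \<lhd> u" using prec_trans[OF u z x] .
  have zR: "z \<in> R" using precD(1)[OF z] .
  have "\<not> (\<forall>y\<in>E z. accepts (t @ [y]) u)"
  proof
    assume acc: "\<forall>y\<in>E z. accepts (t @ [y]) u"
    have "a \<in> U" if a: "a \<in> basic t z" for a
    proof -
      have a': "a \<in> R" "init_seg t a" "\<And>n. length t < n \<Longrightarrow> a n \<in> E z"
        using a unfolding basic_iff by auto
      have "t @ [a (Suc (length t))] = prefix (Suc (length t)) a"
        using a'(2) unfolding init_seg_iff_prefix prefix_def by simp
      then have "a \<in> basic (t @ [a (Suc (length t))]) u"
        using mem_basic_prefix[OF a'(1), of "Suc (length t)" u] a'(3) EV_prec[OF u zu] by simp
      then show ?thesis using acc a'(3)[of "Suc (length t)"] unfolding accepts_def by blast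
    qed
    then have "accepts t z" unfolding accepts_def by blast
    then show False using rej zu unfolding rejects_def by blast
  qed
  then have "\<forall>y\<in>E z. \<not> accepts (t @ [y]) u" using mon by blast
  then have "\<forall>y\<in>E z. after t y \<longrightarrow> rejects (t @ [y]) u" using dec EV_prec[OF u zu] by blast
  then show ?thesis using z by blast
qed

text \<open>If \<open>u\<close> does not accept \<open>t0\<close>, it rejects it, and a second
  fusion spreads rejection to all extensions with words in \<open>E x\<close>. Openness enters at
  the end: a point of \<open>U\<close> in \<open>basic t0 x\<close> would have an initial segment
  accepted by one of its own tails.\<close>

theorem open_Ramsey:
  assumes op: "openin ET U" and t0: "t0 \<in> tuples" and w: "w \<in> R"
  obtains u where "u \<lhd> w" "basic t0 u \<subseteq> U \<or> basic t0 u \<inter> U = {}"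
proof -
  obtain u where u: "u \<lhd> w"
    and dec: "\<And>s. t0 @ s \<in> tuples \<Longrightarrow> set s \<subseteq> E u \<Longrightarrow> accepts (t0 @ s) u \<or> rejects (t0 @ s) u"
    using exists_deciding[OF t0 w] by blast
  have uR: "u \<in> R" using precD(1)[OF u] .
  show thesis
  proof (cases "accepts t0 u")
    case True
    then show thesis using that u unfolding accepts_def by blast
  next
    case False
    then have rej: "rejects t0 u" using dec[of "[]"] t0 by simp
    obtain x where x: "x \<lhd> u"
      and rej_ext: "\<And>s. t0 @ s \<in> tuples \<Longrightarrow> set s \<subseteq> E x \<Longrightarrow> rejects (t0 @ s) u \<Longrightarrow>
        \<forall>y\<in>E x. after (t0 @ s) y \<longrightarrow> rejects (t0 @ s @ [y]) u"
    \<comment> \<open>Rejection refers to the fixed \<open>u\<close> throughout; only the range of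
      the next word shrinks with \<open>x\<close>, so the property is hereditary.\<close>
    proof (rule fusion[OF uR t0, of "\<lambda>t x. rejects t u \<longrightarrow> (\<forall>y\<in>E x. after t y \<longrightarrow> rejects (t @ [y]) u)"])
      fix t x y
      assume "rejects t u \<longrightarrow> (\<forall>y\<in>E x. after t y \<longrightarrow> rejects (t @ [y]) u)"
        "\<And>z. z \<in> E y \<Longrightarrow> after t z \<Longrightarrow> z \<in> E x"
      then show "rejects t u \<longrightarrow> (\<forall>z\<in>E y. after t z \<longrightarrow> rejects (t @ [z]) u)" by blast
    next
      fix s x assume ts: "t0 @ s \<in> tuples" and s: "set s \<subseteq> E u" and x: "x \<lhd> u"
      have xR: "x \<in> R" using precD(1)[OF x] .
      show "\<exists>y. y \<lhd> x \<and> (rejects (t0 @ s) u \<longrightarrow>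
          (\<forall>z\<in>E y. after (t0 @ s) z \<longrightarrow> rejects ((t0 @ s) @ [z]) u))"
      proof (cases "rejects (t0 @ s) u")
        case True
        have "accepts ((t0 @ s) @ [y]) u \<or> rejects ((t0 @ s) @ [y]) u"
          if "y \<in> E u" "after (t0 @ s) y" for y
          using dec[of "s @ [y]"] s tuples_snoc[of "t0 @ s" y] ts that EV_in_words[OF uR] by simp
        then show ?thesis using rejects_extension[OF uR x ts True] by blast
      qed (use prec_refl[OF xR] in blast)
    qed (use that in auto)
    have rej_all: "rejects (t0 @ s) u" if "t0 @ s \<in> tuples" "set s \<subseteq> E x" for s
      using that
    proof (induction s rule: rev_induct)
      case (snoc y s)
      then have "t0 @ s \<in> tuples" "after (t0 @ s) y" "set s \<subseteq> E x" "y \<in> E x"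
        using tuples_snoc[of "t0 @ s" y] by auto
      then show ?case using snoc.IH rej_ext by blast
    qed (use rej in simp)
    have "a \<notin> U" if a: "a \<in> basic t0 x" for a
    proof
      assume "a \<in> U"
      then obtain m where m: "\<And>n. m \<le> n \<Longrightarrow> basic (prefix n a) (tail_seq n a) \<subseteq> U"
        using openin_basic_subset[OF op] by blast
      define n where "n = max m (length t0)"
      have n: "length t0 \<le> n" "m \<le> n" unfolding n_def by auto
      obtain s where s: "prefix n a = t0 @ s" "t0 @ s \<in> tuples" "set s \<subseteq> E x" "a \<in> basic (t0 @ s) x"
        by (rule basic_prefixE[OF a n(1)])
      have a': "a \<in> R" "\<And>i. length t0 < i \<Longrightarrow> a i \<in> E x" using a unfolding basic_iff by auto
      have "tail_seq n a i \<in> E u" if "1 \<le> i" for i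
        using a'(2)[of "n + i"] EV_prec[OF uR x] n(1) that by (simp add: tail_seq_apply)
      then have "tail_seq n a \<lhd> u" using tail_seq_in_R[OF a'(1)] unfolding ev_prec_def by blast
      moreover have "accepts (t0 @ s) (tail_seq n a)" using m[OF n(2)] s(1) unfolding accepts_def by simp
      ultimately show False using rej_all[OF s(2,3)] unfolding rejects_def by blast
    qed
    moreover have "x \<lhd> w" using prec_trans[OF w x u] .
    ultimately show thesis using that by blast
  qed
qed

end

section \<open>Nowhere dense and meager families\<close>

lemma nowhere_dense_avoid:
  assumes N: "nowhere_dense_in ET N" and t: "t \<in> tuples" and w: "w \<in> R"
  obtains u where "u \<lhd> w" "basic t u \<inter> N = {}"
proof -
  \<comment> \<open>The complement of the closure is open, hence decided; if
    \<open>basic t u\<close> were disjoint from it, the closure would contain a nonempty open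
    set.\<close>
  define G where "G = R - ET closure_of N"
  have "openin ET G" unfolding G_def using topspace_ET by (metis closedin_closure_of openin_diff openin_topspace)
  then obtain u where u: "u \<lhd> w" "basic t u \<subseteq> G \<or> basic t u \<inter> G = {}"
    using open_Ramsey[of G t w] t w by blast
  have uR: "u \<in> R" using precD(1)[OF u(1)] .
  have NR: "N \<subseteq> ET closure_of N"
    using N closure_of_subset unfolding nowhere_dense_in_def by blast
  have "\<not> basic t u \<inter> G = {}"
  proof
    assume "basic t u \<inter> G = {}"
    moreover have "basic t u \<subseteq> R" unfolding basic_iff subset_iff by blast
    ultimately have "basic t u \<subseteq> ET closure_of N" unfolding G_def by blast
    then have "basic t u \<subseteq> ET interior_of (ET closure_of N)"
      using openin_basic[OF t uR] by (rule interior_of_maximal)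
    then show False using N basic_nonempty[OF t uR] unfolding nowhere_dense_in_def by blast
  qed
  then have "basic t u \<inter> N = {}" using u(2) NR unfolding G_def by blast
  then show thesis using that u(1) by blast
qed

text \<open>The requirement at a tuple is to miss \<open>N i\<close> for each i up to its length:
  finitely many sets, avoided one after another. A point has initial segments of every length, so it
  lies in no \<open>N i\<close>.\<close>

lemma meager_avoid:
  assumes M: "meager_in ET M" and t: "t \<in> tuples" and w: "w \<in> R"
  obtains u where "u \<lhd> w" "basic t u \<inter> M = {}"
proof -
  obtain N where N: "\<And>i::nat. nowhere_dense_in ET (N i)" and MN: "M = (\<Union>i. N i)"
    using M unfolding meager_in_def by blast
  obtain u where u: "u \<lhd> w"
    and avoid: "\<And>s. t @ s \<in> tuples \<Longrightarrow> set s \<subseteq> E u \<Longrightarrow> \<forall>i\<le>length (t @ s). basic (t @ s) u \<inter> N i = {}"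
  proof (rule fusion[OF w t, of "\<lambda>t x. \<forall>i\<le>length t. basic t x \<inter> N i = {}"])
    fix t x y
    assume "\<forall>i\<le>length t. basic t x \<inter> N i = {}" "\<And>z. z \<in> E y \<Longrightarrow> after t z \<Longrightarrow> z \<in> E x"
    then show "\<forall>i\<le>length t. basic t y \<inter> N i = {}" using basic_mono_after[of y t x] by blast
  next
    fix s x assume ts: "t @ s \<in> tuples" and x: "x \<lhd> w"
    have "\<exists>y. y \<lhd> x \<and> (\<forall>i\<le>m. basic (t @ s) y \<inter> N i = {})" for m
    proof (induction m)
      case 0
      then show ?case using nowhere_dense_avoid[OF N ts precD(1)[OF x], of 0] by (metis le_zero_eq)
    next
      case (Suc m)
      then obtain y where y: "y \<lhd> x" "\<forall>i\<le>m. basic (t @ s) y \<inter> N i = {}" by blast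
      obtain z where z: "z \<lhd> y" "basic (t @ s) z \<inter> N (Suc m) = {}"
        using nowhere_dense_avoid[OF N ts precD(1)[OF y(1)]] by blast
      have "basic (t @ s) z \<subseteq> basic (t @ s) y" using basic_mono[OF precD(1)[OF y(1)] z(1)] .
      then have "\<forall>i\<le>Suc m. basic (t @ s) z \<inter> N i = {}" using y(2) z(2) by (auto simp: le_Suc_eq)
      then show ?case using prec_trans[OF precD(1)[OF x] z(1) y(1)] by blast
    qed
    then show "\<exists>y. y \<lhd> x \<and> (\<forall>i\<le>length (t @ s). basic (t @ s) y \<inter> N i = {})" .
  qed (use that in auto)
  have "a \<notin> N i" if a: "a \<in> basic t u" for a i
  proof -
    obtain s where s: "prefix (max i (length t)) a = t @ s" "t @ s \<in> tuples" "set s \<subseteq> E u" "a \<in> basic (t @ s) u"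
      by (rule basic_prefixE[OF a max.cobounded2])
    have "length (t @ s) = max i (length t)" using s(1) by (metis length_prefix)
    then have "i \<le> length (t @ s)" by simp
    then have "basic (t @ s) u \<inter> N i = {}" using avoid[OF s(2,3)] by blast
    then show ?thesis using s(4) by blast
  qed
  then show thesis using that u unfolding MN by blast
qed

text \<open>Once \<open>M\<close> is avoided, \<open>U\<close> and \<open>G\<close> coincide on the
  basic set, and the open set \<open>G\<close> is decided by \<open>open_Ramsey\<close>.\<close>

lemma Baire_property_imp_completely_Ramsey:
  assumes "Baire_property ET U" shows "completely_Ramsey alpha k v U"
  unfolding completely_Ramsey_def
proof (intro ballI)
  fix t w assume t: "t \<in> tuples" and w: "w \<in> R"
  obtain G M where G: "openin ET G" and M: "meager_in ET M" and U: "U = (G - M) \<union> (M - G)"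
    using assms unfolding Baire_property_def by blast
  obtain u where u: "u \<lhd> w" "basic t u \<inter> M = {}" using meager_avoid[OF M t w] by blast
  have uR: "u \<in> R" using precD(1)[OF u(1)] .
  obtain x where x: "x \<lhd> u" "basic t x \<subseteq> G \<or> basic t x \<inter> G = {}"
    using open_Ramsey[OF G t uR] by blast
  have "basic t x \<inter> M = {}" using u(2) basic_mono[OF uR x(1)] by blast
  moreover have "basic t x \<subseteq> R" unfolding basic_iff subset_iff by blast
  ultimately have "basic t x \<subseteq> U \<or> basic t x \<subseteq> R - U" using x(2) U by blast
  then show "\<exists>u. u \<lhd> w \<and> (basic t u \<subseteq> U \<or> basic t u \<subseteq> R - U)"
    using prec_trans[OF w x(1) u(1)] by blast
qed

lemma completely_Ramsey_imp_Baire_property: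
  assumes UR: "U \<subseteq> R" and cR: "completely_Ramsey alpha k v U"
  shows "Baire_property ET U"
proof -
  define G where "G = ET interior_of U"
  define M where "M = U - G"
  \<comment> \<open>A basic set inside the closure of \<open>M\<close> shrinks to some
    \<open>basic t u\<close> that either is an open subset of \<open>U\<close>, hence part of
    \<open>G\<close>, or misses \<open>U\<close>. In both cases this open set misses
    \<open>M\<close>, hence also the closure of \<open>M\<close> that contains it.\<close>
  have "ET interior_of (ET closure_of M) = {}"
  proof (rule ccontr)
    assume ne: "ET interior_of (ET closure_of M) \<noteq> {}"
    obtain t s where ts: "t \<in> tuples" "s \<in> R" "basic t s \<subseteq> ET interior_of (ET closure_of M)"
      using nonempty_open_basic[OF openin_interior_of ne] by blast
    obtain u where u: "u \<lhd> s" "basic t u \<subseteq> U \<or> basic t u \<subseteq> R - U"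
      using cR ts(1,2) unfolding completely_Ramsey_def by blast
    have uR: "u \<in> R" using precD(1)[OF u(1)] .
    have op: "openin ET (basic t u)" using openin_basic[OF ts(1) uR] .
    have "basic t u \<inter> M = {}"
      using u(2)
    proof
      assume "basic t u \<subseteq> U"
      then have "basic t u \<subseteq> G" unfolding G_def using op by (rule interior_of_maximal)
      then show ?thesis unfolding M_def by blast
    qed (auto simp: M_def)
    then have "basic t u \<inter> ET closure_of M = {}"
      using openin_Int_closure_of_eq_empty[OF op] by blast
    moreover have "basic t u \<subseteq> ET closure_of M"
      using basic_mono[OF ts(2) u(1), of t] ts(3) interior_of_subset by (metis subset_trans)
    ultimately show False using basic_nonempty[OF ts(1) uR] by blast
  qed
  then have nd: "nowhere_dense_in ET M"
    using UR unfolding nowhere_dense_in_def topspace_ET M_def by blast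
  have "meager_in ET M"
    unfolding meager_in_def by (rule exI[of _ "\<lambda>_. M"]) (use nd in simp)
  moreover have "U = (G - M) \<union> (M - G)" using interior_of_subset[of ET U] unfolding M_def G_def by blast
  moreover have "openin ET G" unfolding G_def by simp
  ultimately show ?thesis unfolding Baire_property_def by blast
qed

end

theorem theorem4p7:
  fixes Sigma :: "'a set" and alpha :: "nat \<Rightarrow> 'a" and v :: 'a
    and k :: "nat \<Rightarrow> nat" and U :: "(nat \<Rightarrow> 'a word) set"
  assumes "bij_betw alpha {1..} Sigma"
    and "v \<notin> Sigma"
    and "\<forall>n\<ge>1. 1 \<le> k n"
    and "mono_on {1..} k"
    and "U \<subseteq> word_seqs alpha k v"
  shows "completely_Ramsey alpha k v U \<longleftrightarrow> Baire_property (ellentuck_topology alpha k v) U"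
proof -
  interpret located_words alpha k v
    using assms(1-4) by unfold_locales (auto simp: bij_betw_def)
  show ?thesis
    using Baire_property_imp_completely_Ramsey completely_Ramsey_imp_Baire_property[OF assms(5)] by blast
qed

end
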